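(* For every $\tau\in\mathbb{H}^2$ set $$f(\tau)=\frac{\eta^4(2\tau)\,\eta^8(3\tau)}{\eta^8(\tau)\,\eta^4(6\tau)},\qquad P(\tau)=\frac{\eta(2\tau)\,\eta^6(3\tau)}{\eta^2(\tau)\,\eta^3(6\tau)} .$$ Then the inverse function $\tau=\tau(f)$ yields $P(f)=P(\tau(f))$, and $P(f)$ satisfies the differential equation $$\frac{d^2P}{df^2}+\left\{-\frac1f+\frac{1}{f-1}+\frac{1}{f-\frac19}\right\}\frac{dP}{df}-\frac{f-\frac13}{3f^2(f-1)\left(f-\frac19\right)}\,P=0 .$$
   Context: $\mathbb{H}^2=\{\tau\in\mathbb{C}\mid \Im\tau>0\}$; $\eta(\tau)=e^{2\pi i\tau/24}\prod_{n\ge1}(1-e^{2\pi i n\tau})$ is the Dedekind eta function and $\eta^k(m\tau)=(\eta(m\tau))^k$. The inverse function $\tau=\tau(f)$ means any local holomorphic inverse of $\tau\mapsto f(\tau)$; thus $P$ is regarded locally as a function of the variable $f$. *)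

theory Defs
  imports "HOL-Analysis.Analysis"
begin

definition upper_half_plane :: "complex set" where
  "upper_half_plane = {\<tau>. Im \<tau> > 0}"

text \<open>The product over all positive integers \<open>n\<close> is indexed from \<open>0\<close>, hence \<open>Suc n\<close>.\<close>

definition dedekind_eta :: "complex \<Rightarrow> complex" where
  "dedekind_eta \<tau> =
     exp (2 * of_real pi * \<i> * \<tau> / 24) *
     (\<Prod>n. 1 - exp (2 * of_real pi * \<i> * of_nat (Suc n) * \<tau>))"

definition eta_f :: "complex \<Rightarrow> complex" where
  "eta_f \<tau> = (dedekind_eta (2 * \<tau>) ^ 4 * dedekind_eta (3 * \<tau>) ^ 8) /
              (dedekind_eta \<tau> ^ 8 * dedekind_eta (6 * \<tau>) ^ 4)"

definition eta_P :: "complex \<Rightarrow> complex" where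
  "eta_P \<tau> = (dedekind_eta (2 * \<tau>) * dedekind_eta (3 * \<tau>) ^ 6) /
              (dedekind_eta \<tau> ^ 2 * dedekind_eta (6 * \<tau>) ^ 3)"

text \<open>
  \<open>g\<close> is a holomorphic branch on the open set \<open>U\<close> of the inverse of \<open>F\<close>, where \<open>F\<close> is
  regarded as a function on the upper half plane. The last condition makes \<open>g\<close> injective, so it
  is a two-sided inverse of the restriction of \<open>F\<close> to \<open>g ` U\<close>.
\<close>

definition local_holomorphic_inverse ::
    "(complex \<Rightarrow> complex) \<Rightarrow> complex set \<Rightarrow> (complex \<Rightarrow> complex) \<Rightarrow> bool" where
  "local_holomorphic_inverse F U g \<longleftrightarrow>
     open U \<and> g holomorphic_on U \<and> g ` U \<subseteq> upper_half_plane \<and> (\<forall>w\<in>U. F (g w) = w)"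

end

theory Submission
  imports Defs "HOL-Complex_Analysis.Complex_Analysis"
begin

text \<open>
  Write \<open>D = q d/dq\<close> with \<open>q = exp (2 \<pi> \<i> \<tau>)\<close>. The idea is to parametrise \<open>f\<close> and \<open>P\<close> by values
  of Jacobi's zeta function \<open>J\<close> (the logarithmic derivative of the theta function) at points of
  order three and six. With \<open>z6\<close> a primitive sixth root of unity, put \<open>x = J(z6^2)\<close>,
  \<open>y = J(z6)\<close> and \<open>h = J'(z6^2)\<close>, where the prime is \<open>w d/dw\<close>. Then, for a constant \<open>c\<close>,

  \<^item> \<open>P = c y\<close> and \<open>f = y / (3 (y - 2 x))\<close> (lemma \<open>nome_f_P_eq_torsion\<close>);
  \<^item> \<open>D x = (y - 2 x)^2 (y + x) - x h\<close>, \<open>D y = y (y - 2 x) (y + x) - y h\<close> and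
    \<open>D h = 4 x (y - 2 x)^2 (y + x) - h^2\<close> (lemma \<open>jzeta_torsion_flow\<close>).

  Consequently \<open>D f = 2 (y - 3 x) (y + x) f\<close>, and \<open>d/df\<close> is \<open>D\<close> divided by this expression. It
  turns \<open>P\<close> and its derivatives into rational functions of \<open>x\<close>, \<open>y\<close>, \<open>h\<close>, and the differential
  equation becomes an identity between them (lemma \<open>level6_ode_algebra\<close>). The relation
  \<open>f(\<tau>(f)) = f\<close> forces \<open>D f \<noteq> 0\<close>, so \<open>y - 3 x\<close> and \<open>y + x\<close> do not vanish; up to
  constants, their quotients by \<open>y - 2 x\<close> are
  \<open>f - 1\<close> and \<open>f - 1/9\<close>.

  The system for \<open>x\<close>, \<open>y\<close>, \<open>h\<close> rests on two classical facts: the heat equation of the theta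
  function (\<open>jzeta_heat\<close>) converts \<open>D\<close> into derivatives in the elliptic variable, and the addition
  theorem of the zeta function (\<open>jzeta_addition\<close>), specialised to sixth roots of unity, makes these
  derivatives polynomials in \<open>x\<close>, \<open>y\<close>, \<open>h\<close> (\<open>jzeta_torsion\<close>). Both follow from the same
  principle: a function holomorphic on an annulus and invariant under \<open>w \<mapsto> q w\<close> is constant
  (\<open>nome_periodic_constant\<close>). The proof works with the logarithmic
  derivatives of the theta function, which are Lambert series in \<open>q\<close> and \<open>w\<close> and are easily
  differentiated in both variables.

  The link to the eta function is logarithmic differentiation of Euler's product. At \<open>z6\<close>,
  \<open>z6^2\<close> and \<open>-1\<close> the Lambert series of the heat equation is a combination of the logarithmic
  derivatives of \<open>\<eta>(k \<tau>)\<close> for \<open>k = 1, 2, 3, 6\<close>, so those of \<open>f\<close> and \<open>P\<close> are polynomials in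
  \<open>x\<close>, \<open>y\<close>, \<open>h\<close>. They coincide with the ones that the system gives for \<open>y / (y - 2 x)\<close> and
  \<open>y\<close>, and comparison at \<open>q = 0\<close> fixes the factor in \<open>f\<close>. The differential
  equation is linear, hence the same for \<open>P\<close> and for \<open>y\<close>.
\<close>

section \<open>Power series with Lambert coefficients\<close>

text \<open>
  The term \<open>n = 0\<close> contributes nothing: for \<open>j > 0\<close> its coefficient is a division by
  \<open>(1 - 1) ^ j\<close>, which has the value \<open>0\<close>. So these are the Lambert series over \<open>n \<ge> 1\<close>.
\<close>

definition lambert :: "nat \<Rightarrow> nat \<Rightarrow> complex \<Rightarrow> complex \<Rightarrow> complex" where
  "lambert j k q w = (\<Sum>n. of_nat n ^ k * (q ^ n / (1 - q ^ n) ^ j) * w ^ n)"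

lemma summable_nat_power_times_geometric:
  fixes x :: real
  assumes "\<bar>x\<bar> < 1"
  shows "summable (\<lambda>n. of_nat n ^ k * x ^ n)"
  using assms
proof (induction k arbitrary: x)
  case 0
  then show ?case by (simp add: summable_geometric)
next
  case (Suc k)
  have "summable (\<lambda>n. diffs (\<lambda>n. of_nat n ^ k) n * x ^ n)"
    using Suc by (intro termdiff_converges[of _ 1]) auto
  hence "summable (\<lambda>n. x * (diffs (\<lambda>n. of_nat n ^ k) n * x ^ n))"
    by (rule summable_mult)
  hence "summable (\<lambda>n. of_nat (Suc n) ^ Suc k * x ^ Suc n)"
    by (simp add: diffs_def mult_ac)
  thus ?case
    by (subst (asm) summable_Suc_iff)
qed

lemma norm_one_minus_power_ge:
  fixes q :: complex
  assumes "norm q \<le> r" "r < 1" "n > 0"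
  shows "1 - r \<le> norm (1 - q ^ n)"
proof -
  have "norm (q ^ n) \<le> norm q ^ 1"
    unfolding norm_power using assms by (intro power_decreasing) auto
  moreover have "1 - norm (q ^ n) \<le> norm (1 - q ^ n)"
    using norm_triangle_ineq2[of 1 "q ^ n"] by simp
  ultimately show ?thesis using assms by simp
qed

lemma one_minus_power_nonzero:
  fixes q :: complex
  assumes "norm q < 1" "n > 0"
  shows "1 - q ^ n \<noteq> 0"
  using norm_one_minus_power_ge[of q "norm q" n] assms by auto

text \<open>
  The majorant depends on \<open>q\<close> and \<open>w\<close> only through \<open>r\<close> and \<open>s\<close>, so that it serves for
  neighbourhoods in either variable.
\<close>

lemma norm_lambert_term_le:
  fixes q w :: complex
  assumes "norm q \<le> r" "r < 1" "j > 0" "r * norm w \<le> s"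
  shows "norm (of_nat n ^ k * (q ^ n / (1 - q ^ n) ^ j) * w ^ n)
           \<le> of_nat n ^ k * s ^ n / (1 - r) ^ j"
proof (cases "n = 0")
  case True
  moreover have "0 \<le> of_nat n ^ k * s ^ n / (1 - r) ^ j" if "n = 0"
    using assms(2) that by simp
  ultimately show ?thesis using True assms(3) by (cases k) (auto simp: zero_power)
next
  case False
  have r: "0 \<le> r" using assms(1) norm_ge_zero[of q] by linarith
  have "norm (of_nat n ^ k * (q ^ n / (1 - q ^ n) ^ j) * w ^ n)
      = of_nat n ^ k * (norm q * norm w) ^ n / norm (1 - q ^ n) ^ j"
    by (simp add: norm_mult norm_divide norm_power power_mult_distrib)
  also have "\<dots> \<le> of_nat n ^ k * s ^ n / (1 - r) ^ j"
  proof (intro frac_le mult_left_mono power_mono)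
    show "norm q * norm w \<le> s"
      using mult_right_mono[OF assms(1), of "norm w"] assms(4) by simp
    show "1 - r \<le> norm (1 - q ^ n)"
      using norm_one_minus_power_ge assms False by blast
  qed (use assms r in \<open>auto intro!: mult_nonneg_nonneg zero_le_power
          intro: order_trans[OF _ assms(4)]\<close>)
  finally show ?thesis .
qed

lemma summable_lambert:
  fixes q w :: complex
  assumes "norm q < 1" "j > 0" "norm (q * w) < 1"
  shows "summable (\<lambda>n. of_nat n ^ k * (q ^ n / (1 - q ^ n) ^ j) * w ^ n)"
proof (rule summable_comparison_test'[where N = 0])
  show "summable (\<lambda>n. of_nat n ^ k * (norm q * norm w) ^ n / (1 - norm q) ^ j)"
    by (intro summable_divide summable_nat_power_times_geometric)
       (use assms in \<open>simp add: norm_mult\<close>)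
  show "norm (of_nat n ^ k * (q ^ n / (1 - q ^ n) ^ j) * w ^ n)
          \<le> of_nat n ^ k * (norm q * norm w) ^ n / (1 - norm q) ^ j" for n
    by (rule norm_lambert_term_le) (use assms in auto)
qed

lemma sums_lambert:
  assumes "norm q < 1" "j > 0" "norm (q * w) < 1"
  shows "(\<lambda>n. of_nat n ^ k * (q ^ n / (1 - q ^ n) ^ j) * w ^ n) sums lambert j k q w"
  unfolding lambert_def using summable_lambert[OF assms] by (rule summable_sums)

lemma lambert_at_0 [simp]:
  assumes "j > 0"
  shows "lambert j k 0 w = 0"
proof -
  have "of_nat n ^ k * (0 ^ n / (1 - 0 ^ n) ^ j) * w ^ n = (0::complex)" for n
    using assms by (cases n) auto
  thus ?thesis by (simp only: lambert_def suminf_zero)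
qed

text \<open>
  Only the terms themselves need a local majorant; Cauchy's estimates then control their
  derivatives.
\<close>

lemma series_has_field_derivative:
  fixes f f' :: "nat \<Rightarrow> complex \<Rightarrow> complex"
  assumes S: "open S" "x \<in> S"
    and df: "\<And>n x. x \<in> S \<Longrightarrow> (f n has_field_derivative f' n x) (at x)"
    and bound: "\<And>x. x \<in> S \<Longrightarrow> \<exists>d h. 0 < d \<and> summable (h :: nat \<Rightarrow> real) \<and>
                   (\<forall>n. \<forall>y\<in>ball x d \<inter> S. norm (f n y) \<le> h n)"
  shows "((\<lambda>x. \<Sum>n. f n x) has_field_derivative (\<Sum>n. f' n x)) (at x)"
proof -
  have "\<exists>g g'. \<forall>x \<in> S. ((\<lambda>n. f n x) sums g x) \<and> ((\<lambda>n. f' n x) sums g' x) \<and>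
          (g has_field_derivative g' x) (at x)"
  proof (rule series_and_derivative_comparison_local[OF S(1) df])
    show "\<exists>d h. 0 < d \<and> summable h \<and>
            (\<forall>\<^sub>F n in sequentially. \<forall>y\<in>ball x d \<inter> S. norm (f n y) \<le> h n)" if "x \<in> S" for x
      using bound[OF that] by (blast intro: always_eventually)
  qed
  then obtain g g' where g: "\<And>x. x \<in> S \<Longrightarrow> (\<lambda>n. f n x) sums g x"
      "\<And>x. x \<in> S \<Longrightarrow> (\<lambda>n. f' n x) sums g' x"
      "\<And>x. x \<in> S \<Longrightarrow> (g has_field_derivative g' x) (at x)" by blast
  have "((\<lambda>x. \<Sum>n. f n x) has_field_derivative g' x) (at x)"
    by (rule has_field_derivative_transform_within_open[OF g(3)[OF S(2)] S])
       (use g(1) sums_unique in blast)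
  thus ?thesis using g(2)[OF S(2)] sums_unique by metis
qed

lemma lambert_has_field_derivative:
  assumes "norm q < 1" "j > 0" "norm (q * w) < 1" "w \<noteq> 0"
  shows "(lambert j k q has_field_derivative lambert j (Suc k) q w / w) (at w)"
proof -
  let ?f = "\<lambda>n w. of_nat n ^ k * (q ^ n / (1 - q ^ n) ^ j) * w ^ n"
  let ?f' = "\<lambda>n w. of_nat n ^ Suc k * (q ^ n / (1 - q ^ n) ^ j) * w ^ n / w"
  define S where "S = {w. norm (q * w) < 1} - {0}"
  have S: "open S" unfolding S_def by (intro open_Diff open_Collect_less continuous_intros)
  have "((\<lambda>w. \<Sum>n. ?f n w) has_field_derivative (\<Sum>n. ?f' n w)) (at w)"
  proof (rule series_has_field_derivative[OF S])
    show "w \<in> S" using assms by (auto simp: S_def)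
    fix w assume w: "w \<in> S"
    show "(?f n has_field_derivative ?f' n w) (at w)" for n
    proof -
      have "((\<lambda>w. w ^ n) has_field_derivative of_nat n * w ^ n / w) (at w)"
        by (rule DERIV_cong[OF DERIV_power[OF DERIV_ident]])
           (use w in \<open>cases n; simp add: S_def\<close>)
      from DERIV_cmult[OF this, of "of_nat n ^ k * (q ^ n / (1 - q ^ n) ^ j)"] show ?thesis
        by (simp add: mult_ac)
    qed
    \<comment> \<open>the majorant ratio: halfway between \<open>\<bar>q w\<bar>\<close> and \<open>1\<close>\<close>
    define s where "s = (1 + norm q * norm w) / 2"
    have lt: "norm q * norm w < 1" using w by (auto simp: S_def norm_mult)
    define d where "d = (1 - norm q * norm w) / 2"
    have "norm (?f n y) \<le> of_nat n ^ k * s ^ n / (1 - norm q) ^ j" if "y \<in> ball w d \<inter> S" for n y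
    proof (rule norm_lambert_term_le)
      have "norm y \<le> norm w + d"
        using that norm_triangle_ineq2[of y w] by (auto simp: dist_norm norm_minus_commute)
      hence "norm q * norm y \<le> norm q * norm w + norm q * d"
        by (metis distrib_left mult_left_mono norm_ge_zero)
      also have "norm q * d \<le> 1 * d"
        using assms(1) lt by (intro mult_right_mono) (auto simp: d_def)
      finally show "norm q * norm y \<le> s" unfolding s_def d_def by (simp add: field_simps)
    qed (use assms in auto)
    moreover have "summable (\<lambda>n. of_nat n ^ k * s ^ n / (1 - norm q) ^ j)"
    proof (intro summable_divide summable_nat_power_times_geometric)
      have "0 \<le> norm q * norm w" by simp
      thus "\<bar>s\<bar> < 1" using lt by (simp add: s_def)
    qed
    moreover have "d > 0" using lt by (simp add: d_def)
    ultimately show "\<exists>d h. 0 < d \<and> summable (h :: nat \<Rightarrow> real) \<and>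
              (\<forall>n. \<forall>y\<in>ball w d \<inter> S. norm (?f n y) \<le> h n)"
      by blast
  qed
  moreover have "(\<Sum>n. ?f' n w) = lambert j (Suc k) q w / w"
    unfolding lambert_def using summable_lambert[OF assms(1-3), of "Suc k"] by (rule suminf_divide)
  ultimately show ?thesis by (simp add: lambert_def [abs_def])
qed

text \<open>
  Since \<open>q d/dq\<close> maps \<open>q^n / (1 - q^n)\<close> to \<open>n q^n / (1 - q^n)^2\<close>, differentiation in the
  nome produces the series with \<open>j = 2\<close> and one more factor \<open>n\<close>, which is also what \<open>w d/dw\<close>
  makes of the series with \<open>j = 2\<close>. This agreement is the source of the heat equation. The
  equation for \<open>q * d\<close> also covers the centre \<open>q = 0\<close>, where constants will be evaluated.
\<close>

lemma lambert_has_field_derivative_nome: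
  assumes "norm q < 1" "norm w = 1"
  shows "\<exists>d. ((\<lambda>q. lambert 1 k q w) has_field_derivative d) (at q) \<and> q * d = lambert 2 (Suc k) q w"
proof -
  let ?f = "\<lambda>n q. of_nat n ^ k * (q ^ n / (1 - q ^ n) ^ 1) * w ^ n"
  let ?f' = "\<lambda>n q. of_nat n ^ Suc k * (q ^ (n - 1) / (1 - q ^ n) ^ 2) * w ^ n"
  have d: "((\<lambda>q. \<Sum>n. ?f n q) has_field_derivative (\<Sum>n. ?f' n q)) (at q)"
  proof (rule series_has_field_derivative[OF open_ball[of 0 1]])
    show "q \<in> ball 0 1" using assms by auto
    fix q :: complex assume q: "q \<in> ball 0 1"
    show "(?f n has_field_derivative ?f' n q) (at q)" for n
    proof (cases n)
      case (Suc m)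
      have "1 - q ^ n \<noteq> 0" using one_minus_power_nonzero[of q n] q Suc by auto
      moreover have "((\<lambda>q. q ^ n) has_field_derivative of_nat n * q ^ m) (at q)"
        using Suc DERIV_power_Suc[OF DERIV_ident, of m q UNIV] by simp
      ultimately have "((\<lambda>q. q ^ n / (1 - q ^ n)) has_field_derivative
              (of_nat n * q ^ m * (1 - q ^ n) + q ^ n * (of_nat n * q ^ m)) / (1 - q ^ n)\<^sup>2) (at q)"
        unfolding power2_eq_square using \<open>1 - q ^ n \<noteq> 0\<close>
        by - (rule DERIV_cong[OF DERIV_divide[OF _ DERIV_diff[OF DERIV_const]]], auto)
      also have "of_nat n * q ^ m * (1 - q ^ n) + q ^ n * (of_nat n * q ^ m) = of_nat n * q ^ (n - 1)"
        using Suc by (simp add: algebra_simps)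
      finally have "((\<lambda>q. q ^ n / (1 - q ^ n)) has_field_derivative
                      of_nat n * q ^ (n - 1) / (1 - q ^ n)\<^sup>2) (at q)" .
      from DERIV_cmult[OF this, of "of_nat n ^ k * w ^ n"] show ?thesis
        by (simp add: mult_ac)
    qed (auto intro!: derivative_eq_intros)
    define s where "s = (1 + norm q) / 2"
    have lt: "norm q < 1" using q by auto
    define d where "d = (1 - norm q) / 2"
    have "norm (?f n y) \<le> of_nat n ^ k * s ^ n / (1 - s) ^ 1" if "y \<in> ball q d \<inter> ball 0 1" for n y
    proof (rule norm_lambert_term_le)
      show "norm y \<le> s"
        using that norm_triangle_ineq2[of y q]
        by (auto simp: dist_norm norm_minus_commute s_def d_def field_simps)
      show "s < 1" "s * norm w \<le> s" using lt assms(2) by (auto simp: s_def)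
    qed auto
    moreover have "summable (\<lambda>n. of_nat n ^ k * s ^ n / (1 - s) ^ 1)"
    proof (intro summable_divide summable_nat_power_times_geometric)
      have "0 \<le> s" "s < 1" using lt by (auto simp: s_def)
      thus "\<bar>s\<bar> < 1" by simp
    qed
    moreover have "d > 0" using lt by (simp add: d_def)
    ultimately show "\<exists>d h. 0 < d \<and> summable (h :: nat \<Rightarrow> real) \<and>
              (\<forall>n. \<forall>y\<in>ball q d \<inter> ball 0 1. norm (?f n y) \<le> h n)"
      by blast
  qed
  have eq: "q * ?f' n q = of_nat n ^ Suc k * (q ^ n / (1 - q ^ n) ^ 2) * w ^ n" for n
    by (cases n) (auto simp: field_simps)
  have "q * (\<Sum>n. ?f' n q) = lambert 2 (Suc k) q w"
  proof (cases "q = 0")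
    case False
    have "summable (\<lambda>n. q * ?f' n q)"
      unfolding eq by (rule summable_lambert) (use assms in \<open>auto simp: norm_mult\<close>)
    hence "summable (\<lambda>n. ?f' n q)" using False by (simp only: summable_cmult_iff) simp
    thus ?thesis by (subst suminf_mult[symmetric]) (simp_all only: eq lambert_def)
  qed simp
  with d show ?thesis by (auto simp: lambert_def)
qed

text \<open>
  For \<open>n \<ge> 1\<close> put \<open>u = q^n / (1 - q^n)\<close> and \<open>s = q^n / (1 - q^n)^2\<close>. Then \<open>q^n u = u - q^n\<close>
  and \<open>q^n s = s - u\<close>, and the first equation leaves a geometric series.
\<close>

lemma lambert_shift:
  assumes "norm q < 1" "norm (q * w) < 1"
  shows "lambert 1 0 q (q * w) = lambert 1 0 q w - q * w / (1 - q * w)"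
    and "lambert 2 0 q (q * w) = lambert 2 0 q w - lambert 1 0 q w"
proof -
  have q2: "norm (q * (q * w)) < 1"
  proof -
    have "norm q * norm (q * w) \<le> 1 * norm (q * w)"
      using assms by (intro mult_right_mono) auto
    thus ?thesis using assms by (simp add: norm_mult)
  qed
  have nz: "1 - q ^ n \<noteq> 0" if "n > 0" for n
    using one_minus_power_nonzero assms that by blast
  have g: "(\<lambda>n. (q * w) ^ n - (if n = 0 then 1 else 0)) sums (1 / (1 - q * w) - 1)"
    using assms(2) by (intro sums_diff geometric_sums sums_single)
  have "(\<lambda>n. of_nat n ^ 0 * (q ^ n / (1 - q ^ n) ^ 1) * w ^ n - ((q * w) ^ n - (if n = 0 then 1 else 0)))
          sums (lambert 1 0 q w - (1 / (1 - q * w) - 1))"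
    using assms by (intro sums_diff sums_lambert g) auto
  also have "(\<lambda>n. of_nat n ^ 0 * (q ^ n / (1 - q ^ n) ^ 1) * w ^ n - ((q * w) ^ n - (if n = 0 then 1 else 0)))
           = (\<lambda>n. of_nat n ^ 0 * (q ^ n / (1 - q ^ n) ^ 1) * (q * w) ^ n)"
  proof
    fix n
    show "of_nat n ^ 0 * (q ^ n / (1 - q ^ n) ^ 1) * w ^ n - ((q * w) ^ n - (if n = 0 then 1 else 0))
           = of_nat n ^ 0 * (q ^ n / (1 - q ^ n) ^ 1) * (q * w) ^ n"
      using nz[of n] by (cases "n = 0") (auto simp: field_simps power_mult_distrib)
  qed
  finally have "lambert 1 0 q (q * w) = lambert 1 0 q w - (1 / (1 - q * w) - 1)"
    using sums_lambert[of q 1 "q * w" 0] q2 assms sums_unique2 by force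
  moreover have "1 - q * w \<noteq> 0" using assms(2) by auto
  ultimately show "lambert 1 0 q (q * w) = lambert 1 0 q w - q * w / (1 - q * w)"
    by (simp add: field_simps)
  have "(\<lambda>n. of_nat n ^ 0 * (q ^ n / (1 - q ^ n) ^ 2) * w ^ n - of_nat n ^ 0 * (q ^ n / (1 - q ^ n) ^ 1) * w ^ n)
          sums (lambert 2 0 q w - lambert 1 0 q w)"
    using assms by (intro sums_diff sums_lambert) auto
  also have "(\<lambda>n. of_nat n ^ 0 * (q ^ n / (1 - q ^ n) ^ 2) * w ^ n - of_nat n ^ 0 * (q ^ n / (1 - q ^ n) ^ 1) * w ^ n)
           = (\<lambda>n. of_nat n ^ 0 * (q ^ n / (1 - q ^ n) ^ 2) * (q * w) ^ n)"
  proof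
    fix n
    show "of_nat n ^ 0 * (q ^ n / (1 - q ^ n) ^ 2) * w ^ n - of_nat n ^ 0 * (q ^ n / (1 - q ^ n) ^ 1) * w ^ n
           = of_nat n ^ 0 * (q ^ n / (1 - q ^ n) ^ 2) * (q * w) ^ n"
    proof (cases "n = 0")
      case False
      hence "1 - q ^ n \<noteq> 0" using nz by blast
      thus ?thesis by (simp add: divide_simps power_mult_distrib power2_eq_square) algebra
    qed simp
  qed
  finally show "lambert 2 0 q (q * w) = lambert 2 0 q w - lambert 1 0 q w"
    using sums_lambert[of q 2 "q * w" 0] q2 assms sums_unique2 by force
qed

lemma sums_lambert_1_1_Suc:
  assumes "norm q < 1"
  shows "(\<lambda>n. of_nat (Suc n) * (q ^ Suc n / (1 - q ^ Suc n))) sums lambert 1 1 q 1"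
  using sums_lambert[of q 1 1 1] assms
    sums_Suc_iff[of "\<lambda>n. of_nat n * (q ^ n / (1 - q ^ n))" "lambert 1 1 q 1"] by simp

lemma norm_divisor_double_term:
  fixes q :: complex
  assumes "norm q < 1"
  shows "norm (of_nat (Suc n) * q ^ (Suc n * Suc m)) \<le> (of_nat (Suc n) * norm q ^ n) * norm q ^ m"
proof -
  have "norm q ^ (Suc n * Suc m) \<le> norm q ^ (n + m)"
    using assms by (intro power_decreasing) auto
  thus ?thesis by (simp add: norm_mult norm_power power_add mult_left_mono mult.assoc del: of_nat_Suc)
qed

text \<open>
  Both sides are the double series of \<open>n q^(n m)\<close> over \<open>n, m \<ge> 1\<close>, that is, the generating
  function of the divisor sums, summed in the two possible orders.
\<close>

lemma lambert_at_1_swap: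
  assumes q: "norm q < 1"
  shows "lambert 1 1 q 1 = lambert 2 0 q 1"
proof -
  define f :: "nat \<Rightarrow> nat \<Rightarrow> complex" where "f = (\<lambda>n m. of_nat (Suc n) * q ^ (Suc n * Suc m))"
  have nz: "1 - q ^ Suc n \<noteq> 0" for n
    using one_minus_power_nonzero[OF q, of "Suc n"] by simp
  have lt: "norm (q ^ Suc n) < 1" for n
    using q power_less_one_iff[of "norm q" "Suc n"] by (simp only: norm_power) simp
  have s1: "(\<lambda>m. f n m) sums (of_nat (Suc n) * (q ^ Suc n / (1 - q ^ Suc n)))" for n
  proof -
    have "(\<lambda>m. of_nat (Suc n) * (q ^ Suc n * (q ^ Suc n) ^ m)) sums
            (of_nat (Suc n) * (q ^ Suc n * (1 / (1 - q ^ Suc n))))"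
      by (intro sums_mult geometric_sums lt)
    thus ?thesis unfolding f_def by (simp add: power_mult [symmetric] power_add [symmetric] del: of_nat_Suc power_Suc)
  qed
  have s2: "(\<lambda>n. f n m) sums (q ^ Suc m / (1 - q ^ Suc m) ^ 2)" for m
  proof -
    have "(\<lambda>n. q ^ Suc m * (of_nat (Suc n) * (q ^ Suc m) ^ n)) sums
            (q ^ Suc m * (1 / (1 - q ^ Suc m)^2))"
      by (intro sums_mult geometric_deriv_sums lt)
    moreover have "q ^ Suc m * (of_nat (Suc n) * (q ^ Suc m) ^ n) = f n m" for n
    proof -
      have "q ^ (Suc n * Suc m) = q ^ Suc m * (q ^ Suc m) ^ n"
        unfolding power_mult [symmetric] power_add [symmetric] by (simp add: algebra_simps)
      thus ?thesis unfolding f_def by (simp only: mult_ac)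
    qed
    ultimately show ?thesis by simp
  qed
  have summ: "(\<lambda>(n,m). f n m) summable_on (UNIV \<times> UNIV)"
  proof (rule abs_summable_summable, rule Infinite_Sum.abs_summable_on_comparison_test)
    have "(\<lambda>x. case x of (n, m) \<Rightarrow> real (Suc n) * norm q ^ n * norm q ^ m) summable_on (UNIV \<times> UNIV)"
    proof (rule summable_on_SigmaI)
      have "(\<lambda>m. norm q ^ m) sums (1 / (1 - norm q))"
        using q by (intro geometric_sums) auto
      hence "((\<lambda>m. norm q ^ m) has_sum (1 / (1 - norm q))) UNIV"
        using q by (intro norm_summable_imp_has_sum) (auto simp: norm_power summable_geometric)
      thus "((\<lambda>m. case (n, m) of (n, m) \<Rightarrow> real (Suc n) * norm q ^ n * norm q ^ m)
              has_sum (real (Suc n) * norm q ^ n * (1 / (1 - norm q)))) UNIV" for n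
        unfolding prod.case by (rule has_sum_cmult_right)
      have "(\<lambda>n. of_nat (Suc n) * norm q ^ n) sums (1 / (1 - norm q)\<^sup>2)"
        using q by (intro geometric_deriv_sums) auto
      hence "summable (\<lambda>n. of_nat (Suc n) * norm q ^ n * (1 / (1 - norm q)))"
        by (intro summable_mult2) (auto simp: summable_def)
      thus "(\<lambda>n. of_nat (Suc n) * norm q ^ n * (1 / (1 - norm q))) summable_on UNIV"
        using q by (subst summable_on_UNIV_nonneg_real_iff) auto
    qed auto
    thus "(\<lambda>x. norm (case x of (n, m) \<Rightarrow> real (Suc n) * norm q ^ n * norm q ^ m)) summable_on (UNIV \<times> UNIV)"
      by (simp add: case_prod_beta abs_mult)
    fix x :: "nat \<times> nat"
    show "norm (case x of (n, m) \<Rightarrow> f n m) \<le> norm (case x of (n, m) \<Rightarrow> real (Suc n) * cmod q ^ n * cmod q ^ m)"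
      using norm_divisor_double_term[OF q, of "fst x" "snd x"]
      by (auto simp: f_def case_prod_beta abs_mult simp del: power_Suc)
  qed
  have abs1: "summable (\<lambda>m. norm (f n m))" for n
  proof (rule summable_comparison_test')
    show "summable (\<lambda>m. (of_nat (Suc n) * norm q ^ n) * norm q ^ m)"
      using q by (intro summable_mult summable_geometric) auto
    show "norm (norm (f n m)) \<le> (of_nat (Suc n) * norm q ^ n) * norm q ^ m" for m
      using norm_divisor_double_term[OF q] by (simp add: f_def)
  qed
  have abs2: "summable (\<lambda>n. norm (f n m))" for m
  proof (rule summable_comparison_test')
    show "summable (\<lambda>n. (of_nat (Suc n) * norm q ^ n) * norm q ^ m)"
      using geometric_deriv_sums[of "norm q"] q by (intro summable_mult2) (auto simp: summable_def)
    show "norm (norm (f n m)) \<le> (of_nat (Suc n) * norm q ^ n) * norm q ^ m" for n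
      using norm_divisor_double_term[OF q] by (simp add: f_def)
  qed
  note h1 = sums_lambert_1_1_Suc[OF q]
  have h2: "(\<lambda>m. q ^ Suc m / (1 - q ^ Suc m) ^ 2) sums lambert 2 0 q 1"
    using sums_lambert[of q 2 1 0] q
      sums_Suc_iff[of "\<lambda>n. q ^ n / (1 - q ^ n)\<^sup>2" "lambert 2 0 q 1"] by simp
  have "infsum (\<lambda>n. infsum (\<lambda>m. f n m) UNIV) UNIV = lambert 1 1 q 1"
  proof -
    have "(\<lambda>n. infsum (\<lambda>m. f n m) UNIV) summable_on UNIV"
      using summable_on_Sigma_banach[OF summ] by simp
    hence "(\<lambda>n. infsum (\<lambda>m. f n m) UNIV) sums infsum (\<lambda>n. infsum (\<lambda>m. f n m) UNIV) UNIV"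
      by (intro has_sum_imp_sums has_sum_infsum)
    moreover have "infsum (\<lambda>m. f n m) UNIV = of_nat (Suc n) * (q ^ Suc n / (1 - q ^ Suc n))" for n
      using norm_summable_imp_has_sum[OF abs1 s1] by (rule infsumI)
    ultimately show ?thesis using h1 sums_unique2 by (metis (no_types, lifting) sums_cong)
  qed
  moreover have "infsum (\<lambda>m. infsum (\<lambda>n. f n m) UNIV) UNIV = lambert 2 0 q 1"
  proof -
    have "(\<lambda>(m, n). f n m) summable_on (UNIV \<times> UNIV)"
      using summable_on_swap[of "\<lambda>(m, n). f n m" UNIV UNIV] summ by (simp add: case_prod_beta)
    hence "(\<lambda>m. infsum (\<lambda>n. f n m) UNIV) summable_on UNIV"
      by (rule summable_on_Sigma_banach[where B = "\<lambda>_. UNIV", simplified])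
    hence "(\<lambda>m. infsum (\<lambda>n. f n m) UNIV) sums infsum (\<lambda>m. infsum (\<lambda>n. f n m) UNIV) UNIV"
      by (intro has_sum_imp_sums has_sum_infsum)
    moreover have "infsum (\<lambda>n. f n m) UNIV = q ^ Suc m / (1 - q ^ Suc m) ^ 2" for m
      using norm_summable_imp_has_sum[OF abs2 s2] by (rule infsumI)
    ultimately show ?thesis using h2 sums_unique2 by (metis (no_types, lifting) sums_cong)
  qed
  moreover have "infsum (\<lambda>n. infsum (\<lambda>m. f n m) UNIV) UNIV = infsum (\<lambda>m. infsum (\<lambda>n. f n m) UNIV) UNIV"
    by (rule infsum_swap_banach[OF summ])
  ultimately show ?thesis by simp
qed

section \<open>Jacobi's zeta function on an annulus\<close>

text \<open>
  Two periods of \<open>w \<mapsto> q w\<close>, centred at the unit circle: the Lambert series converge here in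
  \<open>w\<close> and in \<open>1 / w\<close>, and \<open>w = 1\<close> is the only pole of \<open>jzeta\<close> inside.
\<close>

definition nome_annulus :: "complex \<Rightarrow> complex set" where
  "nome_annulus q = {w. norm q < norm w \<and> norm w < 1 / norm q}"

text \<open>
  In the multiplicative variable \<open>w\<close>, \<open>jzeta 0 q\<close> is Jacobi's zeta function: it equals
  \<open>- w d/dw log \<Theta>(w)\<close> for the theta function
  \<open>\<Theta>(w) = q^(1/8) w^(-1/2) (1 - w) \<Prod> (1 - q^n) (1 - q^n w) (1 - q^n / w)\<close>, product over
  \<open>n \<ge> 1\<close>. The index \<open>k\<close> counts applications of \<open>w d/dw\<close>, so \<open>jzeta 1 q\<close> is, up to a
  constant factor and an additive constant, Weierstrass' elliptic function; the higher ones
  are its derivatives.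
\<close>

primrec jzeta :: "nat \<Rightarrow> complex \<Rightarrow> complex \<Rightarrow> complex" where
  "jzeta 0 q w = (1 + w) / (2 * (1 - w)) + (lambert 1 0 q w - lambert 1 0 q (1 / w))"
| "jzeta (Suc k) q w = w * deriv (jzeta k q) w"

declare jzeta.simps [simp del]

lemma open_nome_annulus: "open (nome_annulus q)"
  unfolding nome_annulus_def by (intro open_Collect_conj open_Collect_less continuous_intros)

lemma nome_annulusD:
  assumes "w \<in> nome_annulus q"
  shows "w \<noteq> 0" "norm (q * w) < 1" "norm (q * (1 / w)) < 1" "1 / w \<in> nome_annulus q"
proof -
  have "norm w > 0" "norm w < 1 / norm q" "norm q < norm w"
    using assms norm_ge_zero[of q] by (auto simp: nome_annulus_def)
  moreover from this have "norm q > 0" by (cases "q = 0") auto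
  ultimately show "w \<noteq> 0" "norm (q * w) < 1" "norm (q * (1 / w)) < 1" "1 / w \<in> nome_annulus q"
    by (auto simp: nome_annulus_def norm_mult norm_divide field_simps)
qed

lemma unit_in_nome_annulus:
  assumes "norm w = 1" "norm q < 1" "q \<noteq> 0"
  shows "w \<in> nome_annulus q"
  using assms by (auto simp: nome_annulus_def field_simps)

lemma unit_mult_in_nome_annulus:
  assumes "norm v = 1" "u \<in> nome_annulus q"
  shows "u * v \<in> nome_annulus q"
  using assms by (auto simp: nome_annulus_def norm_mult)

lemma lambert_inverse_has_field_derivative:
  assumes "norm q < 1" "j > 0" "w \<in> nome_annulus q"
  shows "((\<lambda>w. lambert j k q (1 / w)) has_field_derivative - lambert j (Suc k) q (1 / w) / w) (at w)"
proof -
  have "((\<lambda>w. 1 / w) has_field_derivative - 1 / w\<^sup>2) (at w)"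
    using nome_annulusD(1)[OF assms(3)]
    by (auto intro!: derivative_eq_intros simp: power2_eq_square)
  moreover have "(lambert j k q has_field_derivative lambert j (Suc k) q (1 / w) / (1 / w)) (at (1 / w))"
    using nome_annulusD(1,3)[OF assms(3)] assms by (intro lambert_has_field_derivative) auto
  ultimately have "(lambert j k q \<circ> (\<lambda>w. 1 / w) has_field_derivative
      lambert j (Suc k) q (1 / w) / (1 / w) * (- 1 / w\<^sup>2)) (at w)"
    by (intro DERIV_chain)
  thus ?thesis using nome_annulusD(1)[OF assms(3)] by (simp add: o_def power2_eq_square)
qed

lemma holomorphic_lambert:
  assumes "norm q < 1" "j > 0"
  shows "lambert j k q holomorphic_on nome_annulus q"
    and "(\<lambda>w. lambert j k q (1 / w)) holomorphic_on nome_annulus q"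
proof -
  show "lambert j k q holomorphic_on nome_annulus q"
    using lambert_has_field_derivative[OF assms] nome_annulusD(1,2)
    by (meson holomorphic_on_open open_nome_annulus)
  show "(\<lambda>w. lambert j k q (1 / w)) holomorphic_on nome_annulus q"
    using lambert_inverse_has_field_derivative[OF assms]
    by (meson holomorphic_on_open open_nome_annulus)
qed

lemma holomorphic_jzeta:
  assumes "norm q < 1"
  shows "jzeta k q holomorphic_on nome_annulus q - {1}"
proof (induction k)
  case 0
  have "jzeta 0 q = (\<lambda>w. (1 + w) / (2 * (1 - w)) + (lambert 1 0 q w - lambert 1 0 q (1 / w)))"
    by (rule ext) (simp add: jzeta.simps)
  thus ?case
    using holomorphic_lambert[OF assms, of 1 0]
    by (auto intro!: holomorphic_intros intro: holomorphic_on_subset)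
next
  case (Suc k)
  have "jzeta (Suc k) q = (\<lambda>w. w * deriv (jzeta k q) w)" by (rule ext) (simp add: jzeta.simps)
  thus ?case using Suc by (auto intro!: holomorphic_intros open_Diff open_nome_annulus)
qed

lemma jzeta_has_field_derivative:
  assumes "norm q < 1" "w \<in> nome_annulus q" "w \<noteq> 1"
  shows "(jzeta k q has_field_derivative jzeta (Suc k) q w / w) (at w)"
proof -
  have "(jzeta k q has_field_derivative deriv (jzeta k q) w) (at w)"
    using assms by (intro holomorphic_derivI[OF holomorphic_jzeta]) (auto intro: open_Diff open_nome_annulus)
  thus ?thesis using nome_annulusD(1)[OF assms(2)] by (simp add: jzeta.simps)
qed

lemma jzeta_1:
  assumes "norm q < 1" "w \<in> nome_annulus q" "w \<noteq> 1"
  shows "jzeta 1 q w = w / (1 - w)\<^sup>2 + (lambert 1 1 q w + lambert 1 1 q (1 / w))"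
proof -
  note w = nome_annulusD[OF assms(2)]
  have C: "((\<lambda>w. (1 + w) / (2 * (1 - w))) has_field_derivative 1 / (1 - w)\<^sup>2) (at w)"
  proof -
    have "1 * (2 * (1 - w)) - (1 + w) * (- 2) = (4 :: complex)" by (simp add: algebra_simps)
    moreover have "((\<lambda>w. (1 + w) / (2 * (1 - w))) has_field_derivative
        (1 * (2 * (1 - w)) - (1 + w) * (- 2)) / ((2 * (1 - w)) * (2 * (1 - w)))) (at w)"
      using assms(3) by (auto intro!: derivative_eq_intros)
    moreover have "4 / ((2 * (1 - w)) * (2 * (1 - w))) = 1 / (1 - w)\<^sup>2"
    proof -
      have "(2 * (1 - w)) * (2 * (1 - w)) = 4 * (1 - w)\<^sup>2"
        by (simp add: power2_eq_square algebra_simps)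
      thus ?thesis by simp
    qed
    ultimately show ?thesis by metis
  qed
  have "((\<lambda>w. (1 + w) / (2 * (1 - w)) + (lambert 1 0 q w - lambert 1 0 q (1 / w))) has_field_derivative
          1 / (1 - w)\<^sup>2 + (lambert 1 (Suc 0) q w / w - - lambert 1 (Suc 0) q (1 / w) / w)) (at w)"
    using assms w
    by (intro DERIV_add DERIV_diff C lambert_has_field_derivative lambert_inverse_has_field_derivative) auto
  moreover have "jzeta 0 q = (\<lambda>w. (1 + w) / (2 * (1 - w)) + (lambert 1 0 q w - lambert 1 0 q (1 / w)))"
    by (rule ext) (simp add: jzeta.simps)
  ultimately have "jzeta (Suc 0) q w / w =
      1 / (1 - w)\<^sup>2 + (lambert 1 (Suc 0) q w / w - - lambert 1 (Suc 0) q (1 / w) / w)"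
    using DERIV_unique jzeta_has_field_derivative[OF assms] by metis
  thus ?thesis using w(1) by (simp add: field_simps)
qed

lemma jzeta_inverse:
  assumes "norm q < 1" "w \<in> nome_annulus q" "w \<noteq> 1"
  shows "jzeta k q (1 / w) = (-1) ^ Suc k * jzeta k q w"
  using assms(2,3)
proof (induction k arbitrary: w)
  case 0
  then show ?case using nome_annulusD(1)[of w q] by (simp add: jzeta.simps field_simps)
next
  case (Suc k)
  note w = nome_annulusD[OF Suc.prems(1)]
  have "((\<lambda>w. 1 / w) has_field_derivative - 1 / w\<^sup>2) (at w)"
    using w(1) by (auto intro!: derivative_eq_intros simp: power2_eq_square)
  moreover have "(jzeta k q has_field_derivative jzeta (Suc k) q (1 / w) / (1 / w)) (at (1 / w))"
    using w Suc.prems by (intro jzeta_has_field_derivative assms) auto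
  ultimately have "(jzeta k q \<circ> (\<lambda>w. 1 / w) has_field_derivative
      jzeta (Suc k) q (1 / w) / (1 / w) * (- 1 / w\<^sup>2)) (at w)"
    by (intro DERIV_chain)
  moreover have "((\<lambda>w. (-1) ^ Suc k * jzeta k q w) has_field_derivative
                   (-1) ^ Suc k * (jzeta (Suc k) q w / w)) (at w)"
    by (intro DERIV_cmult jzeta_has_field_derivative assms Suc.prems)
  moreover have "(jzeta k q \<circ> (\<lambda>w. 1 / w) has_field_derivative
                   (-1) ^ Suc k * (jzeta (Suc k) q w / w)) (at w)"
    by (rule has_field_derivative_transform_within_open[OF calculation(2)
          open_Diff[OF open_nome_annulus[of q] closed_singleton[of 1]]])
       (use Suc in auto)
  ultimately have "jzeta (Suc k) q (1 / w) / (1 / w) * (- 1 / w\<^sup>2) = (-1) ^ Suc k * (jzeta (Suc k) q w / w)"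
    using DERIV_unique by blast
  thus ?case using w(1) by (simp add: field_simps power2_eq_square)
qed

lemma shift_in_nome_annulus:
  assumes "norm q < 1" "q \<noteq> 0" "1 < norm w" "norm w < 1 / norm q"
  shows "w \<in> nome_annulus q" "w \<noteq> 1" "q * w \<in> nome_annulus q" "q * w \<noteq> 1"
proof -
  have q: "norm q > 0" using assms by simp
  have "norm q * norm w < 1" using assms(4) q by (simp add: field_simps)
  moreover have "norm q * 1 < norm q * norm w"
    using assms(3) q by (intro mult_strict_left_mono) auto
  moreover have "1 < 1 / norm q" using assms by simp
  ultimately have "norm (q * w) < 1" "norm q < norm (q * w)" "1 < 1 / norm q"
    by (simp_all add: norm_mult)
  thus "w \<in> nome_annulus q" "w \<noteq> 1" "q * w \<in> nome_annulus q" "q * w \<noteq> 1"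
    using assms by (auto simp: nome_annulus_def)
qed

text \<open>
  Let \<open>C(w) = (1 + w) / (2 (1 - w))\<close> be the polar part of \<open>jzeta 0\<close>. The rational terms in
  \<open>lambert_shift\<close> reduce \<open>C(q w)\<close> to \<open>1/2\<close> and \<open>C(w)\<close> to \<open>-1/2\<close>; hence the increment \<open>1\<close>. Up
  to sign and a function of \<open>q\<close> alone, the sum in the third equation is \<open>q d/dq log \<Theta>(w)\<close>.
\<close>

lemma jzeta_shift:
  assumes "norm q < 1" "q \<noteq> 0" "1 < norm w" "norm w < 1 / norm q"
  shows "jzeta 0 q (q * w) = jzeta 0 q w + 1" and "jzeta 1 q (q * w) = jzeta 1 q w"
    and "lambert 2 0 q (q * w) + lambert 2 0 q (1 / (q * w))
           = lambert 2 0 q w + lambert 2 0 q (1 / w) - jzeta 0 q w - 1 / 2"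
proof -
  define S where "S = {w :: complex. 1 < norm w \<and> norm w < 1 / norm q}"
  have inS: "w \<in> nome_annulus q \<and> w \<noteq> 1 \<and> q * w \<in> nome_annulus q \<and> q * w \<noteq> 1" if "w \<in> S" for w
    using shift_in_nome_annulus[OF assms(1,2)] that by (simp add: S_def)
  have L: "lambert 1 0 q (q * w) = lambert 1 0 q w - q * w / (1 - q * w)"
       "lambert 1 0 q (1 / w) = lambert 1 0 q (1 / (q * w)) - (1 / w) / (1 - 1 / w)"
       "lambert 2 0 q (q * w) = lambert 2 0 q w - lambert 1 0 q w"
       "lambert 2 0 q (1 / w) = lambert 2 0 q (1 / (q * w)) - lambert 1 0 q (1 / (q * w))"
    if "w \<in> S" for w
    using lambert_shift[of q w] lambert_shift[of q "1 / (q * w)"] inS[OF that] assms(1,2)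
      nome_annulusD[of w q] nome_annulusD[of "q * w" q] by auto
  have shift0: "jzeta 0 q (q * w) = jzeta 0 q w + 1" if "w \<in> S" for w
  proof -
    have e1: "1 / w / (1 - 1 / w) = 1 / (w - 1)"
      using inS[OF that] nome_annulusD(1)[of w q] by (simp add: field_simps)
    have e2: "q * w / (1 - q * w) = - 1 / 2 + (1 + q * w) / (2 * (1 - q * w))"
      using inS[OF that] by (simp add: field_simps)
    have e3: "1 / (w - 1) = - 1 / 2 - (1 + w) / (2 * (1 - w))"
      using inS[OF that] by (simp add: divide_simps)
    show ?thesis
      unfolding jzeta.simps L(1)[OF that] L(2)[OF that] e1 e2 e3 by simp
  qed
  have w: "w \<in> S" using assms by (simp add: S_def)
  show "jzeta 0 q (q * w) = jzeta 0 q w + 1" by (rule shift0[OF w])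
  have "(jzeta 0 q has_field_derivative jzeta 1 q (q * w) / (q * w)) (at (q * w))"
    using inS[OF w] assms jzeta_has_field_derivative[of q "q * w" 0] by simp
  hence "(jzeta 0 q \<circ> (\<lambda>w. q * w) has_field_derivative jzeta 1 q (q * w) / (q * w) * q) (at w)"
    by (rule DERIV_chain) (auto intro!: derivative_eq_intros)
  moreover have "((\<lambda>w. jzeta 0 q w + 1) has_field_derivative jzeta 1 q w / w) (at w)"
    using jzeta_has_field_derivative[of q w 0] inS[OF w] assms by (auto intro!: derivative_eq_intros)
  moreover have "(jzeta 0 q \<circ> (\<lambda>w. q * w) has_field_derivative jzeta 1 q w / w) (at w)"
  proof (rule has_field_derivative_transform_within_open[OF calculation(2)])
    show "open S" unfolding S_def
      by (intro open_Collect_conj open_Collect_less continuous_intros)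
  qed (use w shift0 in auto)
  ultimately have "jzeta 1 q (q * w) / (q * w) * q = jzeta 1 q w / w"
    using DERIV_unique by blast
  thus "jzeta 1 q (q * w) = jzeta 1 q w"
    using assms nome_annulusD(1)[of w q] inS[OF w] by (simp add: field_simps)
  have e: "1 / w / (1 - 1 / w) = - 1 / 2 - (1 + w) / (2 * (1 - w))"
    using inS[OF w] nome_annulusD(1)[of w q] by (simp add: divide_simps)
  show "lambert 2 0 q (q * w) + lambert 2 0 q (1 / (q * w))
           = lambert 2 0 q w + lambert 2 0 q (1 / w) - jzeta 0 q w - 1 / 2"
    unfolding jzeta.simps L(1)[OF w] L(2)[OF w] L(3)[OF w] L(4)[OF w] e by simp
qed

section \<open>Liouville's theorem for the nome\<close>

text \<open>
  Liouville's theorem for elliptic functions. The closed annulus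
  \<open>sqrt \<bar>q\<bar> \<le> \<bar>w\<bar> \<le> 1 / sqrt \<bar>q\<bar>\<close> is a fundamental domain contained in the open annulus, so
  the maximum of \<open>\<bar>G\<bar>\<close> over it is a maximum over the whole open annulus and the maximum
  modulus principle applies.
\<close>

lemma nome_periodic_constant:
  assumes q: "norm q < 1" "q \<noteq> 0"
    and holo: "G holomorphic_on nome_annulus q"
    and per: "\<And>w. 1 < norm w \<Longrightarrow> norm w < 1 / norm q \<Longrightarrow> G (q * w) = G w"
    and z: "z \<in> nome_annulus q"
  shows "G z = G 1"
proof -
  define r where "r = sqrt (norm q)"
  have r: "0 < r" "r < 1" "r * r = norm q" "norm q < r"
    using q by (auto simp: r_def real_less_rsqrt power2_eq_square mult_less_cancel_right1)
  define K where "K = {w::complex. r \<le> norm w \<and> norm w \<le> 1 / r}"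
  have "compact K"
  proof (rule compact_eq_bounded_closed[THEN iffD2], intro conjI)
    show "bounded K" unfolding K_def bounded_iff by blast
    show "closed K" unfolding K_def
      by (intro closed_Collect_conj closed_Collect_le continuous_intros)
  qed
  have sub: "K \<subseteq> nome_annulus q"
  proof
    fix w assume "w \<in> K"
    moreover have "1 / r < 1 / norm q" using r q by (intro divide_strict_left_mono) auto
    ultimately show "w \<in> nome_annulus q" using r by (auto simp: K_def nome_annulus_def)
  qed
  have "1 \<in> K" using r by (auto simp: K_def)
  have "continuous_on K (\<lambda>w. norm (G w))"
    using holomorphic_on_imp_continuous_on[OF holo] sub
    by (intro continuous_intros continuous_on_subset[of "nome_annulus q" G K])
  then obtain w0 where w0: "w0 \<in> K" "\<And>w. w \<in> K \<Longrightarrow> norm (G w) \<le> norm (G w0)"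
    using continuous_attains_sup[OF \<open>compact K\<close>] \<open>1 \<in> K\<close> by (metis empty_iff)
  have max: "norm (G w) \<le> norm (G w0)" if w: "w \<in> nome_annulus q" for w
  proof -
    consider "w \<in> K" | "norm w < r" | "norm w > 1 / r" by (force simp: K_def)
    thus ?thesis
    proof cases
      case 2
      \<comment> \<open>multiplication by the inverse nome brings \<open>w\<close> back into the fundamental annulus\<close>
      have n: "norm (w / q) = norm w / norm q" by (simp add: norm_divide)
      have lo: "1 < norm w / norm q" using w q by (auto simp: nome_annulus_def)
      have hi: "norm w / norm q < 1 / r"
      proof -
        have "norm w / norm q < r / norm q" using 2 q by (intro divide_strict_right_mono) auto
        also have "r / norm q = 1 / r" using r q by (simp add: field_simps)
        finally show ?thesis .
      qed
      have "1 / r < 1 / norm q" using r q by (intro divide_strict_left_mono) auto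
      hence "G (q * (w / q)) = G (w / q)" using lo hi n by (intro per) auto
      moreover have "w / q \<in> K" using lo hi n r by (auto simp: K_def)
      ultimately show ?thesis using w0(2) q by force
    next
      case 3
      have n: "norm (q * w) = norm q * norm w" by (simp add: norm_mult)
      have "1 < 1 / r" using r by simp
      have lo: "r < norm q * norm w"
      proof -
        have "r = norm q * (1 / r)" using r by (simp add: field_simps)
        also have "\<dots> < norm q * norm w" using 3 q by (intro mult_strict_left_mono) auto
        finally show ?thesis .
      qed
      have hi: "norm q * norm w < 1" using nome_annulusD(2)[OF w] by (simp add: norm_mult)
      have "G (q * w) = G w"
        using 3 w \<open>1 < 1 / r\<close> by (intro per) (auto simp: nome_annulus_def)
      moreover have "q * w \<in> K" using lo hi n \<open>1 < 1 / r\<close> by (auto simp: K_def)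
      ultimately show ?thesis using w0(2) by force
    qed (use w0 in auto)
  qed
  have "connected (nome_annulus q)"
    using connected_annulus(1)[of "norm q" "0 :: complex" "1 / norm q"]
    by (simp add: nome_annulus_def)
  hence "G constant_on nome_annulus q"
    using maximum_modulus_principle[OF holo open_nome_annulus _ open_nome_annulus order_refl _ max]
      w0(1) sub by blast
  thus ?thesis using z sub \<open>1 \<in> K\<close> by (auto simp: constant_on_def)
qed

lemma holomorphic_factor_zero:
  assumes "f holomorphic_on S" "open S" "a \<in> S" "f a = 0"
  obtains g where "g holomorphic_on S" "\<And>z. z \<in> S \<Longrightarrow> f z = (z - a) * g z" "g a = deriv f a"
proof -
  define g where "g = (\<lambda>z. if z = a then deriv f a else (f z - f a) / (z - a))"
  have "g holomorphic_on S" unfolding g_def by (rule pole_lemma_open[OF assms(1,2)])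
  moreover have "f z = (z - a) * g z" for z using assms(4) by (auto simp: g_def)
  ultimately show ?thesis using that by (auto simp: g_def)
qed

section \<open>The heat equation and the addition theorem\<close>

text \<open>
  The regular part of \<open>jzeta 0\<close> is odd under \<open>w \<mapsto> 1 / w\<close>, hence vanishes at \<open>w = 1\<close> and can
  cancel one simple pole. The quotient takes at \<open>1\<close> the derivative of the regular part,
  which is twice a series of divisor sums.
\<close>

lemma lambert_difference_factor:
  assumes "norm q < 1" "q \<noteq> 0"
  obtains \<rho> where "\<rho> holomorphic_on nome_annulus q" "\<rho> 1 = 2 * lambert 2 0 q 1"
    "\<And>w. w \<in> nome_annulus q \<Longrightarrow> lambert 1 0 q w - lambert 1 0 q (1 / w) = (w - 1) * \<rho> w"
proof -
  define R where "R = (\<lambda>w. lambert 1 0 q w - lambert 1 0 q (1 / w))"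
  have 1: "1 \<in> nome_annulus q" using assms by (intro unit_in_nome_annulus) auto
  have "R holomorphic_on nome_annulus q"
    unfolding R_def using assms by (intro holomorphic_intros holomorphic_lambert) auto
  then obtain \<rho> where \<rho>: "\<rho> holomorphic_on nome_annulus q"
      "\<And>z. z \<in> nome_annulus q \<Longrightarrow> R z = (z - 1) * \<rho> z" "\<rho> 1 = deriv R 1"
    using holomorphic_factor_zero[OF _ open_nome_annulus 1, of R] by (auto simp: R_def)
  have "(R has_field_derivative lambert 1 (Suc 0) q 1 / 1 - - lambert 1 (Suc 0) q (1 / 1) / 1) (at 1)"
    unfolding R_def using assms 1
    by (intro DERIV_diff lambert_has_field_derivative lambert_inverse_has_field_derivative) auto
  hence "deriv R 1 = 2 * lambert 1 1 q 1" using DERIV_imp_deriv by fastforce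
  hence "\<rho> 1 = 2 * lambert 2 0 q 1" using \<rho>(3) lambert_at_1_swap[OF assms(1)] by simp
  thus ?thesis using that \<rho>(1,2) by (simp add: R_def)
qed

text \<open>
  The heat equation \<open>2 q d/dq \<Theta> = (w d/dw)^2 \<Theta>\<close> in logarithmic form. With
  \<open>C = (1 + w) / (2 (1 - w))\<close>, the polar part of \<open>jzeta 0\<close>, one has \<open>C^2 - w C' = 1/4\<close>; this
  and the preceding factorisation show that the left-hand side extends holomorphically to
  \<open>w = 1\<close>. It is invariant under \<open>w \<mapsto> q w\<close>, because the increment \<open>jzeta 0 + 1/2\<close> of half
  the square cancels that of the Lambert series. So it is a constant, which is its value at
  \<open>w = 1\<close>.
\<close>

lemma jzeta_heat:
  assumes q: "norm q < 1" "q \<noteq> 0" and w: "w \<in> nome_annulus q" "w \<noteq> 1"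
  shows "(jzeta 0 q w ^ 2 - jzeta 1 q w) / 2 + (lambert 2 0 q w + lambert 2 0 q (1 / w)) = 1 / 8 - lambert 2 0 q 1"
proof -
  obtain \<rho> where \<rho>: "\<rho> holomorphic_on nome_annulus q" "\<rho> 1 = 2 * lambert 2 0 q 1"
    "\<And>w. w \<in> nome_annulus q \<Longrightarrow> lambert 1 0 q w - lambert 1 0 q (1 / w) = (w - 1) * \<rho> w"
    using lambert_difference_factor[OF q] by blast
  define G where "G = (\<lambda>w. (1 / 4 - (1 + w) * \<rho> w + ((w - 1) * \<rho> w)\<^sup>2
                       - (lambert 1 1 q w + lambert 1 1 q (1 / w))) / 2 + (lambert 2 0 q w + lambert 2 0 q (1 / w)))"
  have G: "(jzeta 0 q w ^ 2 - jzeta 1 q w) / 2 + (lambert 2 0 q w + lambert 2 0 q (1 / w)) = G w"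
    if "w \<in> nome_annulus q" "w \<noteq> 1" for w
  proof -
    have "((1 + w) / (2 * (1 - w)) + (w - 1) * r)\<^sup>2 - w / (1 - w)\<^sup>2
            = 1 / 4 - (1 + w) * r + ((w - 1) * r)\<^sup>2" for r
    proof -
      have "((2 - d) / (2 * d) + (- d) * r)\<^sup>2 - (1 - d) / d\<^sup>2 = 1 / 4 - (2 - d) * r + ((- d) * r)\<^sup>2"
        if "d \<noteq> 0" for d :: complex
        using that by (simp add: field_simps power2_eq_square)
      from this[of "1 - w"] show ?thesis using \<open>w \<noteq> 1\<close> by simp
    qed
    hence e: "((1 + w) / (2 * (1 - w)) + (w - 1) * \<rho> w)\<^sup>2 - (w / (1 - w)\<^sup>2 + s)
             = 1 / 4 - (1 + w) * \<rho> w + ((w - 1) * \<rho> w)\<^sup>2 - s" for s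
      by (metis diff_diff_eq)
    show ?thesis
      unfolding jzeta_1[OF q(1) that] jzeta.simps(1) \<rho>(3)[OF that(1)] G_def e ..
  qed
  have "G holomorphic_on nome_annulus q"
    unfolding G_def using \<rho>(1) q by (intro holomorphic_intros holomorphic_lambert) auto
  moreover have "G (q * w) = G w" if "1 < norm w" "norm w < 1 / norm q" for w
  proof -
    have "norm q > 0" using q by simp
    have *: "w \<in> nome_annulus q" "w \<noteq> 1" "q * w \<in> nome_annulus q" "q * w \<noteq> 1"
      using q that shift_in_nome_annulus[OF q that] by auto
    show ?thesis
      unfolding G[OF *(1,2), symmetric] G[OF *(3,4), symmetric] jzeta_shift[OF q that]
      by (simp add: field_simps power2_eq_square)
  qed
  ultimately have "G w = G 1" using nome_periodic_constant q w by blast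
  also have "G 1 = 1 / 8 - lambert 2 0 q 1"
    using \<rho>(2) lambert_at_1_swap[OF q(1)] by (simp add: G_def field_simps)
  finally show ?thesis using G w by simp
qed

text \<open>
  This is the addition theorem \<open>(\<zeta>(a) + \<zeta>(b) + \<zeta>(c))^2 = \<wp>(a) + \<wp>(b) + \<wp>(c)\<close> for
  \<open>a + b + c = 0\<close>, with \<open>u\<close>, \<open>v\<close> and \<open>1 / (u v)\<close> in place of \<open>a\<close>, \<open>b\<close>, \<open>c\<close>. Fix \<open>v\<close> and
  regard the left-hand side as a function of \<open>u\<close>. The polar parts alone contribute the
  constant \<open>1/4\<close> by the addition theorem of the cotangent. In the cross term, the sum \<open>c\<close> of
  the polar parts has simple poles at \<open>u = 1\<close> and \<open>u = 1 / v\<close>, and the sum \<open>H\<close> of the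
  regular parts vanishes at both points. So the function is holomorphic and periodic, hence
  constant.
\<close>

lemma jzeta_addition:
  assumes q: "norm q < 1" "q \<noteq> 0" and v: "norm v = 1" "v \<noteq> 1"
    and u: "u \<in> nome_annulus q" "u \<noteq> 1" "u * v \<noteq> 1"
  shows "(jzeta 0 q u + jzeta 0 q v - jzeta 0 q (u * v))\<^sup>2 - (jzeta 1 q u + jzeta 1 q v + jzeta 1 q (u * v))
           = 1 / 4 - 6 * lambert 2 0 q 1"
proof -
  define A where "A = nome_annulus q"
  define R where "R = (\<lambda>w. lambert 1 0 q w - lambert 1 0 q (1 / w))"
  define R1 where "R1 = (\<lambda>w. lambert 1 1 q w + lambert 1 1 q (1 / w))"
  define H where "H = (\<lambda>u. R u + R v - R (u * v))"
  have v0: "v \<noteq> 0" using v by auto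
  have inA: "1 \<in> A" "v \<in> A" "1 / v \<in> A"
    using assms by (auto simp: A_def norm_divide intro!: unit_in_nome_annulus)
  have vA: "u * v \<in> A" if "u \<in> A" for u
    using unit_mult_in_nome_annulus[OF v(1)] that by (simp add: A_def)
  have holR: "R holomorphic_on A" "R1 holomorphic_on A"
    unfolding R_def R1_def A_def using q by (intro holomorphic_intros holomorphic_lambert; simp)+
  have holv: "(\<lambda>u. f (u * v)) holomorphic_on A" if "f holomorphic_on A" for f
  proof -
    have "(\<lambda>u. u * v) holomorphic_on A" by (intro holomorphic_intros)
    from holomorphic_on_compose_gen[OF this that] show ?thesis using vA by (auto simp: o_def)
  qed
  have derR: "(R has_field_derivative R1 w / w) (at w)" if "w \<in> A" for w
  proof -
    have "(R has_field_derivative lambert 1 (Suc 0) q w / w - - lambert 1 (Suc 0) q (1 / w) / w) (at w)"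
      unfolding R_def using q that nome_annulusD[of w q] unfolding A_def
      by (intro DERIV_diff lambert_has_field_derivative lambert_inverse_has_field_derivative) auto
    thus ?thesis by (simp add: R1_def add_divide_distrib)
  qed
  have Rinv: "R (1 / w) = - R w" for w by (simp add: R_def)
  have R1val: "R 1 = 0" by (simp add: R_def)
  have holH: "H holomorphic_on A"
    unfolding H_def by (intro holomorphic_intros holR holv)
  have "H 1 = 0" by (simp add: H_def R1val)
  then obtain H1 where H1: "H1 holomorphic_on A" "\<And>z. z \<in> A \<Longrightarrow> H z = (z - 1) * H1 z" "H1 1 = deriv H 1"
    using holomorphic_factor_zero[OF holH _ inA(1)] open_nome_annulus A_def by metis
  have "H (1 / v) = 0" using v0 by (simp add: H_def R1val Rinv)
  hence "H1 (1 / v) = 0" using H1(2)[OF inA(3)] v by auto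
  then obtain H2 where H2: "H2 holomorphic_on A" "\<And>z. z \<in> A \<Longrightarrow> H1 z = (z - 1 / v) * H2 z"
    using holomorphic_factor_zero[OF H1(1) _ inA(3)] open_nome_annulus A_def by metis
  have "(H has_field_derivative R1 1 - R1 v) (at 1)"
  proof -
    have "(R \<circ> (\<lambda>u. u * v) has_field_derivative R1 v / v * v) (at 1)"
      by (rule DERIV_chain) (use derR[OF inA(2)] in \<open>auto intro!: derivative_eq_intros\<close>)
    thus ?thesis unfolding H_def using derR[OF inA(1)] v0
      by (auto simp: o_def intro!: derivative_eq_intros)
  qed
  hence H2_1: "(1 - 1 / v) * H2 1 = R1 1 - R1 v"
    using DERIV_imp_deriv H1(3) H2(2)[OF inA(1)] by metis
  \<comment> \<open>\<open>T\<close> is the sum of polar parts times \<open>(u - 1) (u - 1 / v)\<close>, a polynomial in \<open>u\<close>\<close>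
  define T where "T = (\<lambda>u. (1 + v) / (2 * (1 - v)) * (u - 1) * (u - 1 / v)
                     - (1 + u) * (u - 1 / v) / 2 + (1 + u * v) * (u - 1) / (2 * v))"
  define G where "G = (\<lambda>u. 1 / 4 + 2 * T u * H2 u + (H u)\<^sup>2 - R1 u - R1 v - R1 (u * v))"
  have G: "(jzeta 0 q u + jzeta 0 q v - jzeta 0 q (u * v))\<^sup>2 - (jzeta 1 q u + jzeta 1 q v + jzeta 1 q (u * v)) = G u"
    if u: "u \<in> A" "u \<noteq> 1" "u * v \<noteq> 1" for u
  proof -
    define C where "C = (\<lambda>w::complex. (1 + w) / (2 * (1 - w)))"
    define C1 where "C1 = (\<lambda>w::complex. w / (1 - w)\<^sup>2)"
    define c where "c = C u + C v - C (u * v)"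
    have jzeta0: "jzeta 0 q w = C w + R w" for w by (simp add: jzeta.simps C_def R_def)
    have jzeta1: "jzeta 1 q w = C1 w + R1 w" if "w \<in> A" "w \<noteq> 1" for w
      using jzeta_1[of q w] that q by (simp add: C1_def R1_def A_def)
    have nz: "1 - u \<noteq> 0" "1 - v \<noteq> 0" "1 - u * v \<noteq> 0" using u v by auto
    \<comment> \<open>the cotangent addition theorem, cleared of denominators\<close>
    have c2: "c\<^sup>2 - (C1 u + C1 v + C1 (u * v)) = 1 / 4"
    proof -
      have "((1 - u)\<^sup>2 * (1 - v)\<^sup>2 * (1 - u * v)\<^sup>2) * (4 * (c\<^sup>2 - (C1 u + C1 v + C1 (u * v))))
              = ((1 - u)\<^sup>2 * (1 - v)\<^sup>2 * (1 - u * v)\<^sup>2) * 1"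
      proof -
        have "2 * (1 - u) * (1 - v) * (1 - u * v) * c
                = (1 + u) * (1 - v) * (1 - u * v) + (1 + v) * (1 - u) * (1 - u * v)
                  - (1 + u * v) * (1 - u) * (1 - v)"
          unfolding c_def C_def using nz by (simp add: divide_simps) algebra
        hence "4 * (1 - u)\<^sup>2 * (1 - v)\<^sup>2 * (1 - u * v)\<^sup>2 * c\<^sup>2
               = ((1 + u) * (1 - v) * (1 - u * v) + (1 + v) * (1 - u) * (1 - u * v)
                  - (1 + u * v) * (1 - u) * (1 - v))\<^sup>2" by algebra
        moreover have "(1 - u)\<^sup>2 * C1 u = u" "(1 - v)\<^sup>2 * C1 v = v" "(1 - u * v)\<^sup>2 * C1 (u * v) = u * v"
          unfolding C1_def using nz by auto
        ultimately show ?thesis by algebra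
      qed
      moreover have "(1 - u)\<^sup>2 * (1 - v)\<^sup>2 * (1 - u * v)\<^sup>2 \<noteq> 0" using nz by simp
      ultimately have "4 * (c\<^sup>2 - (C1 u + C1 v + C1 (u * v))) = 1"
        using mult_left_cancel by blast
      thus ?thesis by (simp add: field_simps)
    qed
    have cH: "c * H u = T u * H2 u"
    proof -
      have "H u = (u - 1) * (u - 1 / v) * H2 u" using H1(2) H2(2) u by simp
      moreover have "c * ((u - 1) * (u - 1 / v)) = T u"
      proof -
        have e1: "C u * (u - 1) = - (1 + u) / 2"
          unfolding C_def using nz by (simp add: field_simps)
        have e2: "C (u * v) * (u - 1 / v) = - (1 + u * v) / (2 * v)"
          unfolding C_def using nz v0 by (simp add: divide_simps) algebra
        have e3: "c * ((u - 1) * (u - 1 / v)) = C u * (u - 1) * (u - 1 / v)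
            + C v * (u - 1) * (u - 1 / v) - C (u * v) * (u - 1 / v) * (u - 1)"
        proof -
          have "(a + b - d) * ((u - 1) * t) = a * (u - 1) * t + b * (u - 1) * t - d * t * (u - 1)"
            for a b d t :: complex by (simp add: algebra_simps)
          thus ?thesis unfolding c_def by blast
        qed
        have "c * ((u - 1) * (u - 1 / v)) = - (1 + u) / 2 * (u - 1 / v)
            + C v * (u - 1) * (u - 1 / v) - - (1 + u * v) / (2 * v) * (u - 1)" by (simp only: e1 e2 e3)
        moreover have "- a / 2 * t + d - - b / (2 * v) * s = d - a * t / 2 + b * s / (2 * v)"
          for a b d s t :: complex by simp
        ultimately show ?thesis by (simp only: T_def C_def)
      qed
      ultimately show ?thesis by (metis mult.assoc)
    qed
    have j0: "jzeta 0 q u + jzeta 0 q v - jzeta 0 q (u * v) = c + H u"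
      unfolding jzeta0 c_def H_def by simp
    have j1: "jzeta 1 q u + jzeta 1 q v + jzeta 1 q (u * v) = C1 u + C1 v + C1 (u * v) + (R1 u + R1 v + R1 (u * v))"
      using jzeta1[OF u(1,2)] jzeta1[OF inA(2) v(2)] jzeta1[OF vA[OF u(1)] u(3)] by simp
    have sq: "(c + H u)\<^sup>2 = c\<^sup>2 + 2 * (c * H u) + (H u)\<^sup>2"
      by (simp add: power2_eq_square algebra_simps)
    have c2': "c\<^sup>2 = 1 / 4 + (C1 u + C1 v + C1 (u * v))"
      using c2 by (simp only: diff_eq_eq)
    show ?thesis unfolding j0 j1 sq cH c2' G_def by (simp add: algebra_simps)
  qed
  have "G holomorphic_on A"
    unfolding G_def T_def by (intro holomorphic_intros holR holv holH H2 ) (use v v0 in auto)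
  moreover have "G (q * w) = G w" if w: "1 < norm w" "norm w < 1 / norm q" for w
  proof -
    have wv: "1 < norm (w * v)" "norm (w * v) < 1 / norm q" using w v by (auto simp: norm_mult)
    have "w \<in> A" "w \<noteq> 1" "q * w \<in> A" "q * w \<noteq> 1" "w * v \<noteq> 1" "q * w * v \<noteq> 1"
      using shift_in_nome_annulus[OF q w] shift_in_nome_annulus[OF q wv]
      by (auto simp: A_def mult.assoc)
    thus ?thesis
      using G[of w] G[of "q * w"] jzeta_shift(1,2)[OF q w] jzeta_shift(1,2)[OF q wv]
      by (simp add: mult.assoc algebra_simps)
  qed
  ultimately have "G u = G 1" using nome_periodic_constant[OF q, of G u] u by (simp add: A_def)
  also have "G 1 = 1 / 4 - 6 * lambert 2 0 q 1"
  proof -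
    have "T 1 = - (1 - 1 / v)" by (simp add: T_def diff_divide_distrib)
    hence e1: "T 1 * H2 1 = R1 v - R1 1" using H2_1 by (metis minus_diff_eq minus_mult_left)
    have e2: "R1 1 = 2 * lambert 2 0 q 1" using lambert_at_1_swap[OF q(1)] by (simp add: R1_def)
    have "G 1 = 1 / 4 + 2 * (T 1 * H2 1) + (H 1)\<^sup>2 - R1 1 - 2 * R1 v"
      by (simp add: G_def)
    also have "\<dots> = 1 / 4 - 3 * R1 1" unfolding e1 using \<open>H 1 = 0\<close> by simp
    finally show ?thesis by (simp add: e2)
  qed
  finally show ?thesis using G[of u] u by (simp add: A_def)
qed

lemma jzeta_mult_has_field_derivative:
  assumes "norm q < 1" "norm v = 1" "u \<in> nome_annulus q" "u * v \<noteq> 1"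
  shows "((\<lambda>u. jzeta k q (u * v)) has_field_derivative jzeta (Suc k) q (u * v) / u) (at u)"
proof -
  have v: "v \<noteq> 0" using assms(2) by auto
  have "(jzeta k q has_field_derivative jzeta (Suc k) q (u * v) / (u * v)) (at (u * v))"
    using assms by (intro jzeta_has_field_derivative unit_mult_in_nome_annulus)
  hence "(jzeta k q \<circ> (\<lambda>u. u * v) has_field_derivative jzeta (Suc k) q (u * v) / (u * v) * v) (at u)"
    by (rule DERIV_chain) (auto intro!: derivative_eq_intros)
  thus ?thesis using v by (simp add: o_def)
qed

lemma has_field_derivative_0_if_constant_on_open:
  assumes "(f has_field_derivative d) (at x)" "open S" "x \<in> S" "\<And>y. y \<in> S \<Longrightarrow> f y = c"
  shows "d = 0"
proof -
  have "(f has_field_derivative 0) (at x)"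
    by (rule has_field_derivative_transform_within_open[OF DERIV_const[of c] assms(2,3)])
       (simp add: assms(4))
  thus ?thesis using assms(1) DERIV_unique by blast
qed

text \<open>
  Apply \<open>u d/du\<close> once and twice to the addition theorem; \<open>u * v\<close> behaves like \<open>u\<close> under this
  operator because \<open>v\<close> is fixed.
\<close>

lemma jzeta_addition_deriv:
  assumes q: "norm q < 1" "q \<noteq> 0" and v: "norm v = 1" "v \<noteq> 1"
    and u: "u \<in> nome_annulus q" "u \<noteq> 1" "u * v \<noteq> 1"
  shows "2 * (jzeta 0 q u + jzeta 0 q v - jzeta 0 q (u * v)) * (jzeta 1 q u - jzeta 1 q (u * v))
           = jzeta 2 q u + jzeta 2 q (u * v)" (is ?th1)
    and "2 * (jzeta 1 q u - jzeta 1 q (u * v))\<^sup>2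
           + 2 * (jzeta 0 q u + jzeta 0 q v - jzeta 0 q (u * v)) * (jzeta 2 q u - jzeta 2 q (u * v))
           = jzeta 3 q u + jzeta 3 q (u * v)" (is ?th2)
proof -
  define S where "S = nome_annulus q - {1, 1 / v}"
  have v0: "v \<noteq> 0" using v by auto
  have S: "open S" unfolding S_def by (intro open_Diff open_nome_annulus) auto
  have inS: "u \<in> S \<longleftrightarrow> u \<in> nome_annulus q \<and> u \<noteq> 1 \<and> u * v \<noteq> 1" for u
    using v0 by (auto simp: S_def field_simps)
  have d: "(jzeta k q has_field_derivative jzeta (Suc k) q u / u) (at u)"
          "((\<lambda>u. jzeta k q (u * v)) has_field_derivative jzeta (Suc k) q (u * v) / u) (at u)"
    if "u \<in> S" for u k
    using that q v by (auto simp: inS intro!: jzeta_has_field_derivative jzeta_mult_has_field_derivative)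
  let ?s = "\<lambda>u. jzeta 0 q u + jzeta 0 q v - jzeta 0 q (u * v)"
  have th1: "2 * ?s u * (jzeta 1 q u - jzeta 1 q (u * v)) - (jzeta 2 q u + jzeta 2 q (u * v)) = 0"
    if "u \<in> S" for u
  proof -
    have u0: "u \<noteq> 0" using that nome_annulusD(1) by (auto simp: inS)
    have "((\<lambda>u. (?s u)\<^sup>2 - (jzeta 1 q u + jzeta 1 q v + jzeta 1 q (u * v))) has_field_derivative
            2 * ?s u * (jzeta 1 q u / u - jzeta 1 q (u * v) / u) - (jzeta 2 q u / u + jzeta 2 q (u * v) / u)) (at u)"
      using d(1)[OF that, of 0] d(2)[OF that, of 0] d(1)[OF that, of 1] d(2)[OF that, of 1]
      by (auto intro!: derivative_eq_intros simp: numeral_2_eq_2)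
    hence "2 * ?s u * (jzeta 1 q u / u - jzeta 1 q (u * v) / u) - (jzeta 2 q u / u + jzeta 2 q (u * v) / u) = 0"
      by (rule has_field_derivative_0_if_constant_on_open[OF _ S that jzeta_addition[OF q v]])
         (auto simp: inS)
    moreover have "2 * ?s u * (jzeta 1 q u / u - jzeta 1 q (u * v) / u) - (jzeta 2 q u / u + jzeta 2 q (u * v) / u)
        = (2 * ?s u * (jzeta 1 q u - jzeta 1 q (u * v)) - (jzeta 2 q u + jzeta 2 q (u * v))) / u"
      by (simp add: diff_divide_distrib add_divide_distrib right_diff_distrib)
    ultimately show ?thesis using u0 by (metis divide_eq_0_iff)
  qed
  have uS: "u \<in> S" using u inS by blast
  have u0: "u \<noteq> 0" using u(1) nome_annulusD(1) by auto
  show ?th1 using th1[OF uS] by simp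
  have "((\<lambda>u. 2 * ?s u * (jzeta 1 q u - jzeta 1 q (u * v)) - (jzeta 2 q u + jzeta 2 q (u * v))) has_field_derivative
         2 * ?s u * (jzeta 2 q u / u - jzeta 2 q (u * v) / u)
         + 2 * (jzeta 1 q u / u - jzeta 1 q (u * v) / u) * (jzeta 1 q u - jzeta 1 q (u * v))
         - (jzeta 3 q u / u + jzeta 3 q (u * v) / u)) (at u)"
    using d(1)[OF uS, of 0] d(2)[OF uS, of 0] d(1)[OF uS, of 1] d(2)[OF uS, of 1]
      d(1)[OF uS, of 2] d(2)[OF uS, of 2]
    by (auto intro!: derivative_eq_intros simp: numeral_2_eq_2 numeral_3_eq_3 mult_ac)
  hence "2 * ?s u * (jzeta 2 q u / u - jzeta 2 q (u * v) / u)
         + 2 * (jzeta 1 q u / u - jzeta 1 q (u * v) / u) * (jzeta 1 q u - jzeta 1 q (u * v))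
         - (jzeta 3 q u / u + jzeta 3 q (u * v) / u) = 0"
    by (rule has_field_derivative_0_if_constant_on_open[OF _ S uS th1])
  moreover have "2 * ?s u * (jzeta 2 q u / u - jzeta 2 q (u * v) / u)
         + 2 * (jzeta 1 q u / u - jzeta 1 q (u * v) / u) * (jzeta 1 q u - jzeta 1 q (u * v))
         - (jzeta 3 q u / u + jzeta 3 q (u * v) / u)
        = (2 * (jzeta 1 q u - jzeta 1 q (u * v))\<^sup>2 + 2 * ?s u * (jzeta 2 q u - jzeta 2 q (u * v))
           - (jzeta 3 q u + jzeta 3 q (u * v))) / u"
    by (simp add: diff_divide_distrib add_divide_distrib right_diff_distrib left_diff_distrib power2_eq_square mult_ac)
  ultimately have "2 * (jzeta 1 q u - jzeta 1 q (u * v))\<^sup>2 + 2 * ?s u * (jzeta 2 q u - jzeta 2 q (u * v))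
           - (jzeta 3 q u + jzeta 3 q (u * v)) = 0"
    using u0 by (metis divide_eq_0_iff)
  thus ?th2 by simp
qed

lemma jzeta_heat_deriv:
  assumes q: "norm q < 1" "q \<noteq> 0" and w: "w \<in> nome_annulus q" "w \<noteq> 1"
  shows "lambert 2 1 q w - lambert 2 1 q (1 / w) = jzeta 2 q w / 2 - jzeta 0 q w * jzeta 1 q w" (is ?th1)
    and "lambert 2 2 q w + lambert 2 2 q (1 / w) = jzeta 3 q w / 2 - (jzeta 1 q w)\<^sup>2 - jzeta 0 q w * jzeta 2 q w" (is ?th2)
proof -
  define S where "S = nome_annulus q - {1}"
  have S: "open S" unfolding S_def by (intro open_Diff open_nome_annulus) auto
  have d: "(jzeta k q has_field_derivative jzeta (Suc k) q w / w) (at w)"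
          "(lambert 2 k q has_field_derivative lambert 2 (Suc k) q w / w) (at w)"
          "((\<lambda>w. lambert 2 k q (1 / w)) has_field_derivative - lambert 2 (Suc k) q (1 / w) / w) (at w)"
    if "w \<in> S" for w k
    using that q nome_annulusD(1,2)
    by (auto simp: S_def intro!: jzeta_has_field_derivative lambert_has_field_derivative
        lambert_inverse_has_field_derivative[simplified])
  have th1: "jzeta 0 q w * jzeta 1 q w - jzeta 2 q w / 2 + (lambert 2 1 q w - lambert 2 1 q (1 / w)) = 0"
    if "w \<in> S" for w
  proof -
    have w0: "w \<noteq> 0" using that nome_annulusD(1) by (auto simp: S_def)
    have "((\<lambda>w. (jzeta 0 q w ^ 2 - jzeta 1 q w) / 2 + (lambert 2 0 q w + lambert 2 0 q (1 / w))) has_field_derivative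
            (2 * jzeta 0 q w * (jzeta 1 q w / w) - jzeta 2 q w / w) / 2
             + (lambert 2 1 q w / w + - lambert 2 1 q (1 / w) / w)) (at w)"
      using d(1)[OF that, of 0] d(1)[OF that, of 1] d(2)[OF that, of 0] d(3)[OF that, of 0]
      by (auto intro!: derivative_eq_intros simp: numeral_2_eq_2)
    hence "(2 * jzeta 0 q w * (jzeta 1 q w / w) - jzeta 2 q w / w) / 2
             + (lambert 2 1 q w / w + - lambert 2 1 q (1 / w) / w) = 0"
      by (rule has_field_derivative_0_if_constant_on_open[OF _ S that jzeta_heat[OF q]])
         (auto simp: S_def)
    moreover have "(2 * jzeta 0 q w * (jzeta 1 q w / w) - jzeta 2 q w / w) / 2
             + (lambert 2 1 q w / w + - lambert 2 1 q (1 / w) / w)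
          = (jzeta 0 q w * jzeta 1 q w - jzeta 2 q w / 2 + (lambert 2 1 q w - lambert 2 1 q (1 / w))) / w"
      by (simp add: diff_divide_distrib add_divide_distrib)
    ultimately show ?thesis using w0 by (metis divide_eq_0_iff)
  qed
  have wS: "w \<in> S" using w by (simp add: S_def)
  have w0: "w \<noteq> 0" using w nome_annulusD(1) by auto
  have solve: "d = c - a" if "a - c + d = 0" for a c d :: complex
    using that by (simp add: add_eq_0_iff)
  show ?th1 using th1[OF wS] by (rule solve)
  have "((\<lambda>w. jzeta 0 q w * jzeta 1 q w - jzeta 2 q w / 2 + (lambert 2 1 q w - lambert 2 1 q (1 / w)))
          has_field_derivative
          jzeta 0 q w * (jzeta 2 q w / w) + (jzeta 1 q w / w) * jzeta 1 q w - jzeta 3 q w / w / 2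
             + (lambert 2 2 q w / w - - lambert 2 2 q (1 / w) / w)) (at w)"
    using d(1)[OF wS, of 0] d(1)[OF wS, of 1] d(1)[OF wS, of 2] d(2)[OF wS, of 1] d(3)[OF wS, of 1]
    by (auto intro!: derivative_eq_intros simp: numeral_2_eq_2 numeral_3_eq_3 mult_ac)
  hence "jzeta 0 q w * (jzeta 2 q w / w) + (jzeta 1 q w / w) * jzeta 1 q w - jzeta 3 q w / w / 2
             + (lambert 2 2 q w / w - - lambert 2 2 q (1 / w) / w) = 0"
    by (rule has_field_derivative_0_if_constant_on_open[OF _ S wS th1])
  moreover have "jzeta 0 q w * (jzeta 2 q w / w) + (jzeta 1 q w / w) * jzeta 1 q w - jzeta 3 q w / w / 2
             + (lambert 2 2 q w / w - - lambert 2 2 q (1 / w) / w)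
        = (jzeta 0 q w * jzeta 2 q w + (jzeta 1 q w)\<^sup>2 - jzeta 3 q w / 2 + (lambert 2 2 q w + lambert 2 2 q (1 / w))) / w"
    by (simp add: diff_divide_distrib add_divide_distrib power2_eq_square)
  ultimately have "(jzeta 0 q w * jzeta 2 q w + (jzeta 1 q w)\<^sup>2) - jzeta 3 q w / 2 + (lambert 2 2 q w + lambert 2 2 q (1 / w)) = 0"
    using w0 by (metis divide_eq_0_iff)
  hence "lambert 2 2 q w + lambert 2 2 q (1 / w) = jzeta 3 q w / 2 - (jzeta 0 q w * jzeta 2 q w + (jzeta 1 q w)\<^sup>2)"
    by (rule solve)
  thus ?th2 by (simp add: algebra_simps)
qed

lemma jzeta_nome_derivative:
  assumes "norm q < 1" "norm w = 1"
  shows "\<exists>d. ((\<lambda>q. jzeta 0 q w) has_field_derivative d) (at q) \<and>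
             q * d = lambert 2 1 q w - lambert 2 1 q (1 / w)"
proof -
  have "norm (1 / w) = 1" using assms by (simp add: norm_divide)
  then obtain d1 d2 where
    "((\<lambda>q. lambert 1 0 q w) has_field_derivative d1) (at q)" "q * d1 = lambert 2 1 q w"
    "((\<lambda>q. lambert 1 0 q (1 / w)) has_field_derivative d2) (at q)" "q * d2 = lambert 2 1 q (1 / w)"
    using lambert_has_field_derivative_nome[OF assms, of 0]
      lambert_has_field_derivative_nome[OF assms(1), of "1 / w" 0] by auto
  thus ?thesis unfolding jzeta.simps
    by (intro exI[of _ "d1 - d2"]) (auto intro!: derivative_eq_intros simp: algebra_simps)
qed

text \<open>
  By termwise differentiation \<open>q d/dq\<close> of \<open>jzeta k\<close> is \<open>(w d/dw)^(k + 1)\<close> of the Lambert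
  series in the heat equation, and that equation expresses the series through \<open>jzeta\<close>.
\<close>

lemma jzeta_nome_derivative_heat:
  assumes "norm q < 1" "q \<noteq> 0" "norm w = 1" "w \<noteq> 1"
  shows "\<exists>d. ((\<lambda>q. jzeta 0 q w) has_field_derivative d) (at q) \<and>
             q * d = jzeta 2 q w / 2 - jzeta 0 q w * jzeta 1 q w"
    and "\<exists>d. ((\<lambda>q. jzeta 1 q w) has_field_derivative d) (at q) \<and>
             q * d = jzeta 3 q w / 2 - (jzeta 1 q w)\<^sup>2 - jzeta 0 q w * jzeta 2 q w"
proof -
  have w: "w \<in> nome_annulus q" using assms by (intro unit_in_nome_annulus)
  show "\<exists>d. ((\<lambda>q. jzeta 0 q w) has_field_derivative d) (at q) \<and>
             q * d = jzeta 2 q w / 2 - jzeta 0 q w * jzeta 1 q w"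
    using jzeta_nome_derivative[of q w] jzeta_heat_deriv(1)[of q w] assms w by auto
  have "norm (1 / w) = 1" using assms by (simp add: norm_divide)
  then obtain d1 d2 where d:
    "((\<lambda>q. lambert 1 1 q w) has_field_derivative d1) (at q)" "q * d1 = lambert 2 2 q w"
    "((\<lambda>q. lambert 1 1 q (1 / w)) has_field_derivative d2) (at q)" "q * d2 = lambert 2 2 q (1 / w)"
    using lambert_has_field_derivative_nome[OF assms(1,3), of 1]
      lambert_has_field_derivative_nome[OF assms(1), of "1 / w" 1] by (auto simp: numeral_2_eq_2)
  define S where "S = ball 0 1 - {0 :: complex}"
  have "((\<lambda>q. w / (1 - w)\<^sup>2 + (lambert 1 1 q w + lambert 1 1 q (1 / w))) has_field_derivative d1 + d2) (at q)"
    using d by (auto intro!: derivative_eq_intros)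
  hence "((\<lambda>q. jzeta 1 q w) has_field_derivative d1 + d2) (at q)"
  proof (rule has_field_derivative_transform_within_open)
    show "open S" "q \<in> S" using assms by (auto simp: S_def)
    show "w / (1 - w)\<^sup>2 + (lambert 1 1 p w + lambert 1 1 p (1 / w)) = jzeta 1 p w" if "p \<in> S" for p
      using that assms by (subst jzeta_1) (auto simp: S_def intro: unit_in_nome_annulus)
  qed
  moreover have "q * (d1 + d2) = jzeta 3 q w / 2 - (jzeta 1 q w)\<^sup>2 - jzeta 0 q w * jzeta 2 q w"
    using jzeta_heat_deriv(2)[of q w] assms w d by (simp add: distrib_left)
  ultimately show "\<exists>d. ((\<lambda>q. jzeta 1 q w) has_field_derivative d) (at q) \<and>
             q * d = jzeta 3 q w / 2 - (jzeta 1 q w)\<^sup>2 - jzeta 0 q w * jzeta 2 q w" by blast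
qed

section \<open>Six-torsion values\<close>

definition z6 :: complex where "z6 = Complex (1 / 2) (sqrt 3 / 2)"

lemma z6_square: "z6\<^sup>2 = z6 - 1"
  by (simp add: z6_def complex_eq_iff power2_eq_square)

lemma z6_powers: "z6 ^ 3 = -1" "z6 ^ 6 = 1"
proof -
  show *: "z6 ^ 3 = -1"
  proof -
    have "z6 ^ 3 = z6 * z6\<^sup>2" by (simp add: power3_eq_cube power2_eq_square)
    also have "\<dots> = z6 * (z6 - 1)" by (simp only: z6_square)
    also have "\<dots> = z6\<^sup>2 - z6" by (simp add: power2_eq_square algebra_simps)
    finally show ?thesis by (simp add: z6_square)
  qed
  have "z6 ^ 6 = (z6 ^ 3) ^ 2" by (simp flip: power_mult)
  thus "z6 ^ 6 = 1" by (simp add: *)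
qed

lemma norm_z6 [simp]: "norm z6 = 1"
  by (simp add: z6_def complex_norm power2_eq_square)

lemma z6_nontrivial: "z6 \<noteq> 0" "z6 \<noteq> 1" "z6\<^sup>2 \<noteq> 1" "z6 \<noteq> -1"
  by (auto simp: z6_def complex_eq_iff power2_eq_square power4_eq_xxxx)

lemma z6_inverse: "z6 ^ 4 = 1 / z6\<^sup>2" "z6 * (-1) = 1 / z6\<^sup>2"
proof -
  have "z6 ^ 4 * z6\<^sup>2 = 1" using z6_powers by (simp flip: power_add)
  moreover have "z6 * (-1) * z6\<^sup>2 = - (z6 ^ 3)" by (simp add: power2_eq_square power3_eq_cube)
  ultimately have "z6 ^ 4 * z6\<^sup>2 = 1" "z6 * (-1) * z6\<^sup>2 = 1" using z6_powers by auto
  thus "z6 ^ 4 = 1 / z6\<^sup>2" "z6 * (-1) = 1 / z6\<^sup>2"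
    using z6_nontrivial(1) by (simp_all add: eq_divide_eq)
qed

text \<open>
  The addition theorem is used at the pairs \<open>(z6^2, z6^2)\<close>, \<open>(z6, z6)\<close> and \<open>(z6, -1)\<close>, whose
  products \<open>1 / z6^2\<close>, \<open>z6^2\<close> and \<open>1 / z6^2\<close> are again sixth roots of unity, so that parity
  in \<open>w\<close> closes the system. The values give \<open>jzeta 1\<close>, the first derivatives at the last two
  pairs give \<open>jzeta 2\<close>, and the second derivative at the first pair gives \<open>jzeta 3\<close>. Hence
  everything is a polynomial in the weight one forms \<open>x\<close>, \<open>y\<close> and the quasimodular \<open>h\<close>. In
  particular the constant of the addition theorem, an Eisenstein series of weight two, is
  \<open>9 x^2 - 3 h\<close>, in which form it accounts for \<open>\<eta>(\<tau>)^3\<close> in the second eta quotient.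
\<close>

lemma jzeta_torsion:
  fixes q :: complex
  assumes q: "norm q < 1" "q \<noteq> 0"
  defines "x \<equiv> jzeta 0 q (z6\<^sup>2)" and "y \<equiv> jzeta 0 q z6" and "h \<equiv> jzeta 1 q (z6\<^sup>2)"
  shows "1 / 4 - 6 * lambert 2 0 q 1 = 9 * x\<^sup>2 - 3 * h"
    and "jzeta 0 q (-1) = 0"
    and "jzeta 1 q z6 = h + 2 * (y - 2 * x) * (y + x)"
    and "jzeta 1 q (-1) = h - (y - 2 * x)\<^sup>2"
    and "jzeta 2 q z6 = 6 * y * (y - 2 * x) * (y + x)"
    and "jzeta 2 q (z6\<^sup>2) = 2 * (y - 2 * x)\<^sup>2 * (y + x)"
    and "jzeta 3 q (z6\<^sup>2) = 6 * x * jzeta 2 q (z6\<^sup>2)"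
proof -
  have A: "z6 \<in> nome_annulus q" "z6\<^sup>2 \<in> nome_annulus q" "-1 \<in> nome_annulus q"
    using q by (auto intro!: unit_in_nome_annulus simp: norm_power)
  note z = z6_nontrivial
  have inv: "jzeta k q (1 / z6\<^sup>2) = (-1) ^ Suc k * jzeta k q (z6\<^sup>2)" for k
    using jzeta_inverse[OF q(1) A(2) z(3)] .
  have p33: "z6\<^sup>2 * z6\<^sup>2 = 1 / z6\<^sup>2" using z6_inverse(1) by (simp flip: power_add)
  have p66: "z6 * z6 = z6\<^sup>2" by (simp add: power2_eq_square)
  have ne: "1 / z6\<^sup>2 \<noteq> 1" using z by simp
  show m1: "jzeta 0 q (-1) = 0" using jzeta_inverse[OF q(1) A(3), of 0] by simp
  have n2: "norm (z6\<^sup>2) = 1" by (simp add: norm_power)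
  have a33: "(3 * x)\<^sup>2 - 3 * h = 1 / 4 - 6 * lambert 2 0 q 1"
    using jzeta_addition[OF q n2 z(3) A(2) z(3)] ne unfolding p33 inv by (simp add: x_def h_def)
  have a66: "(2 * y - x)\<^sup>2 - (2 * jzeta 1 q z6 + h) = 1 / 4 - 6 * lambert 2 0 q 1"
    using jzeta_addition[OF q norm_z6 z(2) A(1) z(2)] z(3) unfolding p66 by (simp add: x_def y_def h_def)
  have a61: "(y + x)\<^sup>2 - (jzeta 1 q z6 + jzeta 1 q (-1) + h) = 1 / 4 - 6 * lambert 2 0 q 1"
    using jzeta_addition[OF q _ _ A(1) z(2), of "-1"] ne unfolding z6_inverse(2) inv m1
    by (simp add: x_def y_def h_def)
  have d61: "2 * (y + x) * (jzeta 1 q z6 - h) = jzeta 2 q z6 - jzeta 2 q (z6\<^sup>2)"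
    using jzeta_addition_deriv(1)[OF q _ _ A(1) z(2), of "-1"] ne unfolding z6_inverse(2) inv m1
    by (simp add: x_def y_def h_def)
  have d66: "2 * (2 * y - x) * (jzeta 1 q z6 - h) = jzeta 2 q z6 + jzeta 2 q (z6\<^sup>2)"
    using jzeta_addition_deriv(1)[OF q norm_z6 z(2) A(1) z(2)] z(3) unfolding p66
    by (simp add: x_def y_def h_def)
  have d33: "2 * (3 * x) * (2 * jzeta 2 q (z6\<^sup>2)) = 2 * jzeta 3 q (z6\<^sup>2)"
    using jzeta_addition_deriv(2)[OF q n2 z(3) A(2) z(3)] ne unfolding p33 inv by (simp add: x_def)
  show "1 / 4 - 6 * lambert 2 0 q 1 = 9 * x\<^sup>2 - 3 * h"
    using a33 by (simp add: power2_eq_square)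
  show h1: "jzeta 1 q z6 = h + 2 * (y - 2 * x) * (y + x)"
  proof -
    have "2 * jzeta 1 q z6 = 2 * (h + 2 * (y - 2 * x) * (y + x))"
      using a33 a66 by algebra
    thus ?thesis by (simp only: mult_cancel_left) simp
  qed
  show "jzeta 1 q (-1) = h - (y - 2 * x)\<^sup>2"
    using a33 a61 h1 by algebra
  have "2 * jzeta 2 q z6 = 2 * (6 * y * (y - 2 * x) * (y + x))"
    using d61 d66 h1 by algebra
  thus "jzeta 2 q z6 = 6 * y * (y - 2 * x) * (y + x)" by (simp only: mult_cancel_left) simp
  have "2 * jzeta 2 q (z6\<^sup>2) = 2 * (2 * (y - 2 * x)\<^sup>2 * (y + x))"
    using d61 d66 h1 by algebra
  thus "jzeta 2 q (z6\<^sup>2) = 2 * (y - 2 * x)\<^sup>2 * (y + x)" by (simp only: mult_cancel_left) simp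
  show "jzeta 3 q (z6\<^sup>2) = 6 * x * jzeta 2 q (z6\<^sup>2)" using d33 by (simp add: mult_ac)
qed

text \<open>
  An autonomous system, the level six analogue of Ramanujan's differential equations for the
  Eisenstein series of weights two, four and six.
\<close>

lemma jzeta_torsion_flow:
  fixes q :: complex
  assumes q: "norm q < 1" "q \<noteq> 0"
  defines "x \<equiv> jzeta 0 q (z6\<^sup>2)" and "y \<equiv> jzeta 0 q z6" and "h \<equiv> jzeta 1 q (z6\<^sup>2)"
  shows "\<exists>d. ((\<lambda>q. jzeta 0 q (z6\<^sup>2)) has_field_derivative d) (at q) \<and>
             q * d = (y - 2 * x)\<^sup>2 * (y + x) - x * h"
    and "\<exists>d. ((\<lambda>q. jzeta 0 q z6) has_field_derivative d) (at q) \<and>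
             q * d = y * (y - 2 * x) * (y + x) - y * h"
    and "\<exists>d. ((\<lambda>q. jzeta 1 q (z6\<^sup>2)) has_field_derivative d) (at q) \<and>
             q * d = 4 * x * (y - 2 * x)\<^sup>2 * (y + x) - h\<^sup>2"
proof -
  have n2: "norm (z6\<^sup>2) = 1" by (simp add: norm_power)
  note t = jzeta_torsion[OF q, folded x_def y_def h_def]
  show "\<exists>d. ((\<lambda>q. jzeta 0 q (z6\<^sup>2)) has_field_derivative d) (at q) \<and>
             q * d = (y - 2 * x)\<^sup>2 * (y + x) - x * h"
    using jzeta_nome_derivative_heat(1)[OF q n2 z6_nontrivial(3)] t(6) by (simp add: x_def h_def)
  have e: "y * (y - 2 * x) * (y + x) - y * h
      = 6 * y * (y - 2 * x) * (y + x) / 2 - y * (h + 2 * (y - 2 * x) * (y + x))"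
    by (simp add: algebra_simps diff_divide_distrib add_divide_distrib)
  show "\<exists>d. ((\<lambda>q. jzeta 0 q z6) has_field_derivative d) (at q) \<and>
             q * d = y * (y - 2 * x) * (y + x) - y * h"
    using jzeta_nome_derivative_heat(1)[OF q norm_z6 z6_nontrivial(2)] 
    unfolding t(3) t(5) e unfolding y_def .
  have e: "4 * x * (y - 2 * x)\<^sup>2 * (y + x) - h\<^sup>2
      = 6 * x * (2 * (y - 2 * x)\<^sup>2 * (y + x)) / 2 - h\<^sup>2 - x * (2 * (y - 2 * x)\<^sup>2 * (y + x))"
    by (simp add: algebra_simps diff_divide_distrib add_divide_distrib)
  show "\<exists>d. ((\<lambda>q. jzeta 1 q (z6\<^sup>2)) has_field_derivative d) (at q) \<and>
             q * d = 4 * x * (y - 2 * x)\<^sup>2 * (y + x) - h\<^sup>2"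
    using jzeta_nome_derivative_heat(2)[OF q n2 z6_nontrivial(3)]
    unfolding t(7) t(6) e unfolding x_def h_def .
qed

section \<open>The Euler product\<close>

definition euler_product :: "complex \<Rightarrow> complex" where
  "euler_product q = (\<Prod>n. 1 - q ^ Suc n)"

lemma convergent_euler_product:
  fixes q :: complex
  assumes "norm q < 1"
  shows "convergent_prod (\<lambda>n. 1 - q ^ Suc n)"
proof -
  have "summable (\<lambda>n. norm (- (q ^ Suc n)))"
    using assms unfolding norm_minus_cancel norm_power
    by (subst summable_Suc_iff) (simp add: summable_geometric)
  moreover have "- (q ^ Suc n) \<noteq> -1" for n
    using one_minus_power_nonzero[OF assms, of "Suc n"] by auto
  ultimately have "convergent_prod (\<lambda>n. 1 + - (q ^ Suc n))"
    by (rule summable_imp_convergent_prod_complex)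
  thus ?thesis by simp
qed

lemma euler_product_nonzero:
  assumes "norm q < 1"
  shows "euler_product q \<noteq> 0"
  unfolding euler_product_def
  by (rule prodinf_nonzero[OF convergent_euler_product[OF assms]])
     (use one_minus_power_nonzero[OF assms] in blast)

lemma euler_product_0 [simp]: "euler_product 0 = 1"
  by (simp add: euler_product_def)

text \<open>
  Locally uniform convergence is what allows the product to be differentiated
  logarithmically, factor by factor.
\<close>

lemma uniform_limit_euler_product:
  assumes r: "0 \<le> r" "r < 1"
  shows "uniform_limit (cball 0 r) (\<lambda>N q. \<Prod>n<N. 1 - q ^ Suc n) euler_product sequentially"
proof -
  have "uniformly_convergent_on (cball 0 r) (\<lambda>N q::complex. \<Prod>n<N. 1 - q ^ Suc n)"
  proof (rule uniformly_convergent_on_prod')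
    have "uniform_limit (cball 0 r) (\<lambda>N q::complex. \<Sum>n<N. norm ((1 - q ^ Suc n) - 1))
            (\<lambda>q. \<Sum>n. norm ((1 - q ^ Suc n) - 1)) sequentially"
    proof (rule Weierstrass_m_test)
      show "summable (\<lambda>n. r ^ Suc n)" using r by (subst summable_Suc_iff) (simp add: summable_geometric)
      fix n and q :: complex assume "q \<in> cball 0 r"
      hence "norm q \<le> r" by simp
      hence "norm q ^ Suc n \<le> r ^ Suc n" by (intro power_mono) auto
      thus "norm (norm ((1 - q ^ Suc n) - 1)) \<le> r ^ Suc n"
        by (simp add: norm_mult norm_power)
    qed
    thus "uniformly_convergent_on (cball 0 r) (\<lambda>N q::complex. \<Sum>n<N. norm ((1 - q ^ Suc n) - 1))"
      by (auto simp: uniformly_convergent_on_def)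
  qed (auto intro!: continuous_intros)
  then obtain l where l: "uniform_limit (cball 0 r) (\<lambda>N q::complex. \<Prod>n<N. 1 - q ^ Suc n) l sequentially"
    by (auto simp: uniformly_convergent_on_def)
  have "l q = euler_product q" if "q \<in> cball 0 r" for q
  proof -
    have "norm q < 1" using that r by simp
    have "(\<lambda>N. \<Prod>n<N. 1 - q ^ Suc n) \<longlonglongrightarrow> l q"
      by (rule tendsto_uniform_limitI[OF l that])
    hence "(\<lambda>N. \<Prod>n\<le>N. 1 - q ^ Suc n) \<longlonglongrightarrow> l q"
      using LIMSEQ_Suc[of "\<lambda>N. \<Prod>n<N. 1 - q ^ Suc n"] by (simp only: lessThan_Suc_atMost)
    moreover have "(\<lambda>N. \<Prod>n\<le>N. 1 - q ^ Suc n) \<longlonglongrightarrow> euler_product q"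
      unfolding euler_product_def
      by (rule convergent_prod_LIMSEQ[OF convergent_euler_product[OF \<open>norm q < 1\<close>]])
    ultimately show ?thesis by (rule LIMSEQ_unique)
  qed
  thus ?thesis using l by (subst (asm) uniform_limit_cong'[of _ _ "\<lambda>N q. \<Prod>n<N. 1 - q ^ Suc n" _ euler_product]) auto
qed

text \<open>
  Logarithmic differentiation yields the Lambert series with coefficients
  \<open>n q^n / (1 - q^n)\<close>; in the form with \<open>j = 2\<close> it can be compared with the heat equation.
\<close>

lemma euler_product_has_field_derivative:
  assumes "norm q < 1"
  shows "\<exists>d. (euler_product has_field_derivative d) (at q) \<and>
             q * d = - euler_product q * lambert 2 0 q 1"
proof -
  have holo: "euler_product holomorphic_on ball 0 1"
  proof (rule holomorphic_uniform_sequence)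
    fix x :: complex assume x: "x \<in> ball 0 1"
    define d where "d = (1 - norm x) / 2"
    have "cball x d \<subseteq> cball 0 ((1 + norm x) / 2)"
    proof
      fix y assume "y \<in> cball x d"
      hence "norm y \<le> norm x + d"
        using norm_triangle_ineq2[of y x] by (auto simp: dist_norm norm_minus_commute)
      thus "y \<in> cball 0 ((1 + norm x) / 2)" by (simp add: d_def field_simps)
    qed
    moreover have "uniform_limit (cball 0 ((1 + norm x) / 2)) (\<lambda>N q. \<Prod>n<N. 1 - q ^ Suc n) euler_product sequentially"
      using x by (intro uniform_limit_euler_product) auto
    ultimately have "uniform_limit (cball x d) (\<lambda>N q. \<Prod>n<N. 1 - q ^ Suc n) euler_product sequentially"
      by (rule uniform_limit_on_subset[rotated])
    moreover have "cball x d \<subseteq> ball 0 1"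
      by (rule order_trans[OF \<open>cball x d \<subseteq> cball 0 ((1 + norm x) / 2)\<close>]) (use x in auto)
    moreover have "d > 0" using x by (simp add: d_def)
    ultimately show "\<exists>d>0. cball x d \<subseteq> ball 0 1 \<and>
        uniform_limit (cball x d) (\<lambda>N q. \<Prod>n<N. 1 - q ^ Suc n) euler_product sequentially"
      by blast
  qed (auto intro!: holomorphic_intros)
  hence d: "(euler_product has_field_derivative deriv euler_product q) (at q)"
    using assms by (intro holomorphic_derivI[of _ "ball 0 1"]) auto
  define r where "r = (1 + norm q) / 2"
  have r: "norm q < r" "r < 1" "0 \<le> r" using assms by (auto simp: r_def)
  have ev: "deriv (\<lambda>q. 1 - q ^ Suc k) q = - (of_nat (Suc k) * q ^ k)" for k
    by (rule DERIV_imp_deriv) (auto intro!: derivative_eq_intros simp del: power_Suc)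
  have "(\<lambda>k. deriv (\<lambda>q. 1 - q ^ Suc k) q / (1 - q ^ Suc k)) sums
          (deriv euler_product q / euler_product q)"
  proof (rule logderiv_prodinf_complex_uniform_limit)
    show "uniform_limit (ball 0 r) (\<lambda>n x. \<Prod>k<n. 1 - x ^ Suc k) euler_product sequentially"
      using uniform_limit_on_subset[OF uniform_limit_euler_product[OF r(3,2)]] by auto
    show "q \<in> ball 0 r" using r by simp
  qed (use euler_product_nonzero[OF assms] in \<open>auto intro!: holomorphic_intros\<close>)
  hence "(\<lambda>k. q * (deriv (\<lambda>q. 1 - q ^ Suc k) q / (1 - q ^ Suc k))) sums
          (q * (deriv euler_product q / euler_product q))" by (rule sums_mult)
  moreover have "q * (deriv (\<lambda>q. 1 - q ^ Suc k) q / (1 - q ^ Suc k))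
      = - (of_nat (Suc k) * (q ^ Suc k / (1 - q ^ Suc k)))" for k
    unfolding ev by simp
  ultimately have "(\<lambda>k. - (of_nat (Suc k) * (q ^ Suc k / (1 - q ^ Suc k)))) sums
          (q * (deriv euler_product q / euler_product q))" by simp
  moreover have "(\<lambda>k. - (of_nat (Suc k) * (q ^ Suc k / (1 - q ^ Suc k)))) sums (- lambert 1 1 q 1)"
    by (intro sums_minus sums_lambert_1_1_Suc assms)
  ultimately have "q * (deriv euler_product q / euler_product q) = - lambert 1 1 q 1"
    by (rule sums_unique2)
  hence "q * deriv euler_product q = - euler_product q * lambert 2 0 q 1"
    using euler_product_nonzero[OF assms] lambert_at_1_swap[OF assms] by (simp add: field_simps)
  with d show ?thesis by blast
qed

lemma euler_product_power_has_field_derivative: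
  assumes "norm q < 1" "k > 0"
  shows "\<exists>d. ((\<lambda>q. euler_product (q ^ k)) has_field_derivative d) (at q) \<and>
             q * d = - of_nat k * lambert 2 0 (q ^ k) 1 * euler_product (q ^ k)"
proof -
  have "norm (q ^ k) < 1" using assms by (simp add: norm_power power_less_one_iff)
  then obtain d where d: "(euler_product has_field_derivative d) (at (q ^ k))"
      "q ^ k * d = - euler_product (q ^ k) * lambert 2 0 (q ^ k) 1"
    using euler_product_has_field_derivative by blast
  have "(euler_product \<circ> (\<lambda>q. q ^ k) has_field_derivative d * (of_nat k * q ^ (k - 1))) (at q)"
    using d(1) by (rule DERIV_chain) (auto intro!: derivative_eq_intros)
  moreover have "q * (d * (of_nat k * q ^ (k - 1))) = of_nat k * (q ^ k * d)"
    using assms(2) by (cases k) auto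
  hence "q * (d * (of_nat k * q ^ (k - 1))) = - of_nat k * lambert 2 0 (q ^ k) 1 * euler_product (q ^ k)"
    unfolding d(2) by simp
  ultimately show ?thesis unfolding o_def by blast
qed

section \<open>Lambert series at sixth roots of unity\<close>

text \<open>
  The terms whose index is a multiple of \<open>k\<close> form the same series with nome \<open>q^k\<close>.
\<close>

lemma sums_lambert_section:
  assumes "norm q < 1" "k > 0"
  shows "(\<lambda>n. (if k dvd n then 1 else 0) * (q ^ n / (1 - q ^ n)\<^sup>2)) sums lambert 2 0 (q ^ k) 1"
proof -
  have "norm (q ^ k) < 1" using assms by (simp add: norm_power power_less_one_iff)
  hence "(\<lambda>n. (q ^ k) ^ n / (1 - (q ^ k) ^ n)\<^sup>2) sums lambert 2 0 (q ^ k) 1"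
    using sums_lambert[of "q ^ k" 2 1 0] by simp
  also have "(\<lambda>n. (q ^ k) ^ n / (1 - (q ^ k) ^ n)\<^sup>2)
      = (\<lambda>n. (\<lambda>n. (if k dvd n then 1 else 0) * (q ^ n / (1 - q ^ n)\<^sup>2)) (k * n))"
    by (simp add: power_mult)
  also have "\<dots> sums lambert 2 0 (q ^ k) 1 \<longleftrightarrow>
      (\<lambda>n. (if k dvd n then 1 else 0) * (q ^ n / (1 - q ^ n)\<^sup>2)) sums lambert 2 0 (q ^ k) 1"
  proof (rule sums_mono_reindex)
    show "strict_mono ((*) k)" using assms(2) by (auto simp: strict_mono_def)
  qed (auto simp: dvd_def)
  finally show ?thesis .
qed

text \<open>
  The left-hand side is the 6-periodic sequence \<open>2, 1, -1, -2, -1, 1\<close>; the traces of the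
  powers of \<open>z6^2\<close> and \<open>-1\<close> are subsequences of it.
\<close>

lemma z6_trace:
  "z6 ^ n + (1 / z6) ^ n = 1 - 2 * (if 2 dvd n then 1 else 0) - 3 * (if 3 dvd n then 1 else 0)
                            + 6 * (if 6 dvd n then 1 else 0)"
proof -
  define t where "t = 1 - z6"
  have zt: "z6 * t = 1" using z6_square by (simp add: t_def power2_eq_square algebra_simps)
  have t: "1 / z6 = t" using zt z6_nontrivial(1) by (simp add: field_simps)
  have t6: "t ^ 6 = 1" using z6_powers(2) by (simp flip: t add: power_divide)
  have p: "z6 ^ n = z6 ^ (n mod 6)" "t ^ n = t ^ (n mod 6)"
    using power_add[of z6 "6 * (n div 6)" "n mod 6"] power_add[of t "6 * (n div 6)" "n mod 6"] t6 z6_powers(2)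
    by (simp_all add: power_mult)
  have dv: "k dvd n \<longleftrightarrow> k dvd n mod 6" if "k dvd 6" for k :: nat using that by (simp add: dvd_mod_iff)
  have zp: "z6 ^ 3 = -1" "z6 ^ 4 = - z6" "z6 ^ 5 = t" "t ^ 2 = - z6" "t ^ 3 = -1" "t ^ 4 = z6 - 1" "t ^ 5 = z6"
  proof -
    show z3: "z6 ^ 3 = -1" by (rule z6_powers)
    show z4: "z6 ^ 4 = - z6" using power_add[of z6 3 1] z3 by simp
    show z5: "z6 ^ 5 = t" using power_add[of z6 3 2] z3 z6_square by (simp add: t_def)
    show t2: "t ^ 2 = - z6" using z6_square by (simp add: t_def power2_eq_square algebra_simps)
    show t3: "t ^ 3 = -1" using power_add[of t 2 1] t2 zt by simp
    show "t ^ 4 = z6 - 1" using power_add[of t 3 1] t3 by (simp add: t_def)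
    show "t ^ 5 = z6" using power_add[of t 3 2] t3 t2 by simp
  qed
  have "n mod 6 < 6" by simp
  hence "n mod 6 \<in> {0, 1, 2, 3, 4, 5}" by auto
  thus ?thesis unfolding t p using dv[of 2] dv[of 3] dv[of 6] z6_square zp
    by (auto simp: t_def)
qed

text \<open>
  Hence the heat equation at sixth roots of unity speaks about the logarithmic derivatives
  of \<open>\<eta>(\<tau>)\<close>, \<open>\<eta>(2 \<tau>)\<close>, \<open>\<eta>(3 \<tau>)\<close> and \<open>\<eta>(6 \<tau>)\<close>: the theta function at \<open>z6\<close>, \<open>z6^2\<close> and \<open>-1\<close> is
  an eta quotient of level six.
\<close>

lemma lambert_torsion:
  assumes q: "norm q < 1"
  defines "N \<equiv> \<lambda>k. lambert 2 0 (q ^ k) 1"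
  shows "lambert 2 0 q z6 + lambert 2 0 q (1 / z6) = N 1 - 2 * N 2 - 3 * N 3 + 6 * N 6"
    and "lambert 2 0 q (z6\<^sup>2) + lambert 2 0 q (1 / z6\<^sup>2) = 3 * N 3 - N 1"
    and "lambert 2 0 q (-1) + lambert 2 0 q (-1) = 4 * N 2 - 2 * N 1"
proof -
  define s where "s = (\<lambda>n. q ^ n / (1 - q ^ n)\<^sup>2)"
  have L: "(\<lambda>n. (w ^ n + (1 / w) ^ n) * s n) sums (lambert 2 0 q w + lambert 2 0 q (1 / w))"
    if "norm w = 1" for w
  proof -
    have "(\<lambda>n. of_nat n ^ 0 * (q ^ n / (1 - q ^ n)\<^sup>2) * w ^ n + of_nat n ^ 0 * (q ^ n / (1 - q ^ n)\<^sup>2) * (1 / w) ^ n)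
            sums (lambert 2 0 q w + lambert 2 0 q (1 / w))"
      using q that by (intro sums_add sums_lambert) (auto simp: norm_mult norm_divide)
    thus ?thesis by (simp add: s_def algebra_simps add_divide_distrib)
  qed
  have S: "(\<lambda>n. (if k dvd n then 1 else 0) * s n) sums N k" if "k > 0" for k
    using sums_lambert_section[OF q that] by (simp add: s_def N_def)
  have S1: "s sums N 1" using S[of 1] by simp
  have "(\<lambda>n. s n - 2 * ((if 2 dvd n then 1 else 0) * s n) - 3 * ((if 3 dvd n then 1 else 0) * s n)
           + 6 * ((if 6 dvd n then 1 else 0) * s n)) sums (N 1 - 2 * N 2 - 3 * N 3 + 6 * N 6)"
    by (intro sums_add sums_diff sums_mult S S1) auto
  moreover have "(\<lambda>n. (z6 ^ n + (1 / z6) ^ n) * s n) = (\<lambda>n. s n - 2 * ((if 2 dvd n then 1 else 0) * s n) - 3 * ((if 3 dvd n then 1 else 0) * s n)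
           + 6 * ((if 6 dvd n then 1 else 0) * s n))"
    unfolding z6_trace by (simp add: algebra_simps)
  ultimately show "lambert 2 0 q z6 + lambert 2 0 q (1 / z6) = N 1 - 2 * N 2 - 3 * N 3 + 6 * N 6"
    using L[of z6] sums_unique2 by fastforce
  have "(\<lambda>n. 3 * ((if 3 dvd n then 1 else 0) * s n) - s n) sums (3 * N 3 - N 1)"
    by (intro sums_add sums_diff sums_mult S S1) auto
  moreover have "((z6\<^sup>2) ^ n + (1 / z6\<^sup>2) ^ n) * s n = 3 * ((if 3 dvd n then 1 else 0) * s n) - s n" for n
  proof -
    have "3 dvd 2 * n \<longleftrightarrow> 3 dvd n" "6 dvd 2 * n \<longleftrightarrow> 3 dvd n" by presburger+
    thus ?thesis using z6_trace[of "2 * n"] by (simp add: power_mult power_divide)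
  qed
  ultimately show "lambert 2 0 q (z6\<^sup>2) + lambert 2 0 q (1 / z6\<^sup>2) = 3 * N 3 - N 1"
    using L[of "z6\<^sup>2"] sums_unique2 by (fastforce simp: norm_power)
  have "(\<lambda>n. 4 * ((if 2 dvd n then 1 else 0) * s n) - 2 * s n) sums (4 * N 2 - 2 * N 1)"
    by (intro sums_add sums_diff sums_mult S S1) auto
  moreover have "((-1) ^ n + (1 / (-1)) ^ n) * s n = 4 * ((if 2 dvd n then 1 else 0) * s n) - 2 * s n" for n
    by simp
  ultimately show "lambert 2 0 q (-1) + lambert 2 0 q (-1) = 4 * N 2 - 2 * N 1"
    using L[of "-1"] sums_unique2 by fastforce
qed

section \<open>The level six functions\<close>

text \<open>
  The operator \<open>q d/dq\<close> as a relation, so that differentiability is part of it. Logarithmic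
  derivatives are written as \<open>v = k * f q\<close>, without a division by \<open>f q\<close>.
\<close>

definition nome_deriv :: "(complex \<Rightarrow> complex) \<Rightarrow> complex \<Rightarrow> complex \<Rightarrow> bool" where
  "nome_deriv f v q \<longleftrightarrow> (\<exists>d. (f has_field_derivative d) (at q) \<and> q * d = v)"

lemma nome_deriv_mult:
  assumes "nome_deriv f (k * f q) q" "nome_deriv g (l * g q) q"
  shows "nome_deriv (\<lambda>q. f q * g q) ((k + l) * (f q * g q)) q"
proof -
  obtain d e where "(f has_field_derivative d) (at q)" "q * d = k * f q"
     "(g has_field_derivative e) (at q)" "q * e = l * g q"
    using assms by (auto simp: nome_deriv_def)
  moreover have "q * (d * g q + e * f q) = (q * d) * g q + (q * e) * f q"
    by (simp add: algebra_simps)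
  ultimately show ?thesis unfolding nome_deriv_def
    by (intro exI[of _ "d * g q + e * f q"]) (auto intro!: derivative_eq_intros simp: algebra_simps)
qed

lemma nome_deriv_power:
  assumes "nome_deriv f (k * f q) q"
  shows "nome_deriv (\<lambda>q. f q ^ n) ((of_nat n * k) * f q ^ n) q"
proof (induction n)
  case 0
  then show ?case by (auto simp: nome_deriv_def intro!: exI[of _ 0])
next
  case (Suc n)
  from nome_deriv_mult[OF assms Suc] show ?case by (simp add: algebra_simps)
qed

lemma nome_deriv_divide:
  assumes "nome_deriv f (k * f q) q" "nome_deriv g (l * g q) q" "g q \<noteq> 0"
  shows "nome_deriv (\<lambda>q. f q / g q) ((k - l) * (f q / g q)) q"
proof -
  obtain d e where de: "(f has_field_derivative d) (at q)" "q * d = k * f q"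
     "(g has_field_derivative e) (at q)" "q * e = l * g q"
    using assms by (auto simp: nome_deriv_def)
  have "q * ((d * g q - f q * e) / (g q * g q)) = ((q * d) * g q - f q * (q * e)) / (g q * g q)"
    by (simp add: algebra_simps)
  also have "\<dots> = (k - l) * (f q / g q)"
    unfolding de using assms(3) by (simp add: field_simps)
  finally show ?thesis unfolding nome_deriv_def
    using DERIV_divide[OF de(1,3) assms(3)] by blast
qed

lemma nome_deriv_diff_cmult:
  assumes "nome_deriv f u q" "nome_deriv g v q"
  shows "nome_deriv (\<lambda>q. f q - c * g q) (u - c * v) q"
proof -
  obtain d e where "(f has_field_derivative d) (at q)" "q * d = u"
     "(g has_field_derivative e) (at q)" "q * e = v"
    using assms by (auto simp: nome_deriv_def)
  thus ?thesis unfolding nome_deriv_def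
    by (intro exI[of _ "d - c * e"]) (auto intro!: derivative_eq_intros simp: algebra_simps)
qed

lemma nome_deriv_0_imp_constant:
  assumes diff: "\<And>q. norm q < 1 \<Longrightarrow> f field_differentiable at q"
    and deriv: "\<And>q. norm q < 1 \<Longrightarrow> q \<noteq> 0 \<Longrightarrow> nome_deriv f 0 q"
    and q: "norm q < 1"
  shows "f q = f 0"
proof -
  have "f constant_on ball 0 1"
  proof (rule DERIV_zero_connected_constant_on)
    show "finite {0 :: complex}" by simp
    show "continuous_on (ball 0 1) f"
      using diff by (auto intro!: continuous_at_imp_continuous_on field_differentiable_imp_continuous_at)
    show "\<forall>q\<in>ball 0 1 - {0}. (f has_field_derivative 0) (at q)"
      using deriv by (fastforce simp: nome_deriv_def)
  qed auto
  thus ?thesis using q by (auto simp: constant_on_def)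
qed

text \<open>
  The two eta quotients as functions of \<open>q = exp (2 \<pi> \<i> \<tau>)\<close>, holomorphic on the whole disc
  including the cusp \<open>q = 0\<close>.
\<close>

definition nome_f :: "complex \<Rightarrow> complex" where
  "nome_f q = (euler_product (q ^ 2) ^ 4 * euler_product (q ^ 3) ^ 8) /
           (euler_product (q ^ 1) ^ 8 * euler_product (q ^ 6) ^ 4)"

definition nome_P :: "complex \<Rightarrow> complex" where
  "nome_P q = (euler_product (q ^ 2) * euler_product (q ^ 3) ^ 6) /
           (euler_product (q ^ 1) ^ 2 * euler_product (q ^ 6) ^ 3)"

lemma euler_product_power_nonzero:
  assumes "norm q < 1" "k > 0"
  shows "euler_product (q ^ k) \<noteq> 0"
  using assms by (intro euler_product_nonzero) (simp add: norm_power power_less_one_iff)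

lemma nome_f_P_nonzero:
  assumes "norm q < 1"
  shows "nome_f q \<noteq> 0" "nome_P q \<noteq> 0"
  using euler_product_power_nonzero[OF assms] euler_product_nonzero[OF assms]
  by (auto simp: nome_f_def nome_P_def)

lemma eta_power_eq:
  "dedekind_eta (of_nat k * \<tau>) = exp (2 * of_real pi * \<i> * \<tau> / 24) ^ k *
     euler_product (exp (2 * of_real pi * \<i> * \<tau>) ^ k)"
proof -
  have "exp (2 * of_real pi * \<i> * of_nat (Suc n) * (of_nat k * \<tau>)) =
          (exp (2 * of_real pi * \<i> * \<tau>) ^ k) ^ Suc n" for n
    by (simp add: exp_of_nat_mult [symmetric] power_mult [symmetric] mult_ac
             del: power_Suc of_nat_Suc flip: of_nat_mult)
  moreover have "exp (2 * of_real pi * \<i> * (of_nat k * \<tau>) / 24) = exp (2 * of_real pi * \<i> * \<tau> / 24) ^ k"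
    by (simp add: exp_of_nat_mult [symmetric] mult_ac)
  ultimately show ?thesis unfolding dedekind_eta_def euler_product_def by presburger
qed

text \<open>
  The fractional powers of \<open>q\<close> cancel, because \<open>2 * 4 + 3 * 8 = 8 + 6 * 4\<close> and
  \<open>2 + 3 * 6 = 2 + 6 * 3\<close>.
\<close>

lemma eta_f_P_eq:
  "eta_f \<tau> = nome_f (exp (2 * of_real pi * \<i> * \<tau>))"
  "eta_P \<tau> = nome_P (exp (2 * of_real pi * \<i> * \<tau>))"
proof -
  define E where "E = exp (2 * of_real pi * \<i> * \<tau> / 24)"
  have E: "E \<noteq> 0" by (simp add: E_def)
  note e = eta_power_eq[of _ \<tau>, folded E_def]
  have e': "dedekind_eta (1 * \<tau>) = E ^ 1 * euler_product (exp (2 * of_real pi * \<i> * \<tau>) ^ 1)"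
    "dedekind_eta (2 * \<tau>) = E ^ 2 * euler_product (exp (2 * of_real pi * \<i> * \<tau>) ^ 2)"
    "dedekind_eta (3 * \<tau>) = E ^ 3 * euler_product (exp (2 * of_real pi * \<i> * \<tau>) ^ 3)"
    "dedekind_eta (6 * \<tau>) = E ^ 6 * euler_product (exp (2 * of_real pi * \<i> * \<tau>) ^ 6)"
    using e[of 1] e[of 2] e[of 3] e[of 6] by simp_all
  have e1: "dedekind_eta \<tau> = E * euler_product (exp (2 * of_real pi * \<i> * \<tau>) ^ 1)"
    using e'(1) by simp
  have "(E ^ 2 * a) ^ 4 * (E ^ 3 * b) ^ 8 / ((E * c) ^ 8 * (E ^ 6 * d) ^ 4) = a ^ 4 * b ^ 8 / (c ^ 8 * d ^ 4)"
    for a b c d :: complex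
  proof -
    have "(E ^ 2 * a) ^ 4 * (E ^ 3 * b) ^ 8 = E ^ 32 * (a ^ 4 * b ^ 8)"
      "(E * c) ^ 8 * (E ^ 6 * d) ^ 4 = E ^ 32 * (c ^ 8 * d ^ 4)"
      by (simp_all add: power_mult_distrib mult_ac flip: power_mult power_add)
    thus ?thesis using E by simp
  qed
  thus "eta_f \<tau> = nome_f (exp (2 * of_real pi * \<i> * \<tau>))"
    unfolding eta_f_def nome_f_def e'(2-4) e1 .
  have "(E ^ 2 * a) * (E ^ 3 * b) ^ 6 / ((E * c) ^ 2 * (E ^ 6 * d) ^ 3) = a * b ^ 6 / (c ^ 2 * d ^ 3)"
    for a b c d :: complex
  proof -
    have p1: "(E ^ 2 * a) * (E ^ 3 * b) ^ 6 = E ^ 20 * (a * b ^ 6)"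
      using power_add[of E 2 18] by (simp add: power_mult_distrib mult_ac flip: power_mult)
    have p2: "(E * c) ^ 2 * (E ^ 6 * d) ^ 3 = E ^ 20 * (c ^ 2 * d ^ 3)"
      using power_add[of E 2 18] by (simp add: power_mult_distrib mult_ac flip: power_mult)
    show ?thesis unfolding p1 p2 using E by simp
  qed
  thus "eta_P \<tau> = nome_P (exp (2 * of_real pi * \<i> * \<tau>))"
    unfolding eta_P_def nome_P_def e'(2-4) e1 .
qed

lemma nome_f_P_nome_deriv:
  assumes q: "norm q < 1"
  defines "N \<equiv> \<lambda>k. lambert 2 0 (q ^ k) 1"
  shows "nome_deriv nome_f ((8 * N 1 - 8 * N 2 - 24 * N 3 + 24 * N 6) * nome_f q) q"
    and "nome_deriv nome_P ((2 * N 1 - 2 * N 2 - 18 * N 3 + 18 * N 6) * nome_P q) q"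
proof -
  have e: "nome_deriv (\<lambda>q. euler_product (q ^ k)) ((- of_nat k * N k) * euler_product (q ^ k)) q"
    if "k > 0" for k
    using euler_product_power_has_field_derivative[OF q that] by (simp add: nome_deriv_def N_def)
  have nz: "euler_product (q ^ k) \<noteq> 0" if "k > 0" for k
    using euler_product_power_nonzero[OF q that] .
  have "nome_deriv nome_f (((of_nat 4 * (- of_nat 2 * N 2) + of_nat 8 * (- of_nat 3 * N 3))
          - (of_nat 8 * (- of_nat 1 * N 1) + of_nat 4 * (- of_nat 6 * N 6))) * nome_f q) q"
    unfolding nome_f_def
    by (intro nome_deriv_divide nome_deriv_mult nome_deriv_power e) (use nz[of 1] nz[of 6] in auto)
  thus "nome_deriv nome_f ((8 * N 1 - 8 * N 2 - 24 * N 3 + 24 * N 6) * nome_f q) q"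
    by (simp add: algebra_simps)
  have "nome_deriv nome_P ((((- of_nat 2 * N 2) + of_nat 6 * (- of_nat 3 * N 3))
          - (of_nat 2 * (- of_nat 1 * N 1) + of_nat 3 * (- of_nat 6 * N 6))) * nome_P q) q"
    unfolding nome_P_def
    by (intro nome_deriv_divide nome_deriv_mult nome_deriv_power e) (use nz[of 1] nz[of 6] in auto)
  thus "nome_deriv nome_P ((2 * N 1 - 2 * N 2 - 18 * N 3 + 18 * N 6) * nome_P q) q"
    by (simp add: algebra_simps)
qed

text \<open>
  Up to constants, the first quotient is \<open>(\<Theta>(z6^2) / \<Theta>(z6))^4\<close> and the second is
  \<open>\<Theta>(z6^2)^3 \<eta>(\<tau>)^3 / (\<Theta>(-1) \<Theta>(z6)^3)\<close>. The heat equation gives each of these logarithmic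
  derivatives in terms of \<open>jzeta\<close>; that of \<open>\<eta>(\<tau>)^3\<close> is half the constant of the addition
  theorem.
\<close>

lemma nome_f_P_nome_deriv_torsion:
  assumes q: "norm q < 1" "q \<noteq> 0"
  defines "x \<equiv> jzeta 0 q (z6\<^sup>2)" and "y \<equiv> jzeta 0 q z6" and "h \<equiv> jzeta 1 q (z6\<^sup>2)"
  shows "nome_deriv nome_f ((2 * (y - 3 * x) * (y + x)) * nome_f q) q"
    and "nome_deriv nome_P (((y - 2 * x) * (y + x) - h) * nome_P q) q"
proof -
  define N where "N = (\<lambda>k. lambert 2 0 (q ^ k) 1)"
  note t = jzeta_torsion[OF q, folded x_def y_def h_def]
  have A: "z6 \<in> nome_annulus q" "z6\<^sup>2 \<in> nome_annulus q" "-1 \<in> nome_annulus q"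
    using q by (auto intro!: unit_in_nome_annulus simp: norm_power)
  have N1: "lambert 2 0 q 1 = N 1" by (simp add: N_def)
  \<comment> \<open>clears the denominators of the three instances of the heat equation\<close>
  have scale: "4 * a + 8 * b = 1 - 8 * c" if "a / 2 + b = 1 / 8 - c" for a b c :: complex
  proof -
    have "4 * a + 8 * b = 8 * (a / 2 + b)" by simp
    thus ?thesis unfolding that by (simp add: right_diff_distrib)
  qed
  have K: "1 / 4 - 6 * N 1 = 9 * x\<^sup>2 - 3 * h" using t(1) N1 by simp
  have "(y\<^sup>2 - (h + 2 * (y - 2 * x) * (y + x))) / 2 + (N 1 - 2 * N 2 - 3 * N 3 + 6 * N 6) = 1 / 8 - N 1"
    using jzeta_heat[OF q A(1) z6_nontrivial(2)]
    unfolding lambert_torsion(1)[OF q(1), folded N_def] t(3) N1 by (simp only: y_def N_def)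
  note h6 = scale[OF this]
  have "(x\<^sup>2 - h) / 2 + (3 * N 3 - N 1) = 1 / 8 - N 1"
    using jzeta_heat[OF q A(2) z6_nontrivial(3)]
    unfolding lambert_torsion(2)[OF q(1), folded N_def] N1 by (simp only: x_def h_def N_def)
  note h3 = scale[OF this]
  have "(0\<^sup>2 - (h - (y - 2 * x)\<^sup>2)) / 2 + (4 * N 2 - 2 * N 1) = 1 / 8 - N 1"
    using jzeta_heat[OF q A(3)]
    unfolding t(2) t(4) N1 using lambert_torsion(3)[OF q(1), folded N_def] by (simp add: N_def)
  note h2 = scale[OF this, simplified zero_power2 diff_0]
  have K': "1 - 24 * N 1 = 4 * (9 * x\<^sup>2 - 3 * h)" unfolding K [symmetric] by simp
  have f: "8 * N 1 - 8 * N 2 - 24 * N 3 + 24 * N 6 = 2 * (y - 3 * x) * (y + x)"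
  proof -
    have "2 * (8 * N 1 - 8 * N 2 - 24 * N 3 + 24 * N 6) = 2 * (2 * (y - 3 * x) * (y + x))"
      using h6 h3 by algebra
    thus ?thesis by (simp only: mult_cancel_left) simp
  qed
  show "nome_deriv nome_f ((2 * (y - 3 * x) * (y + x)) * nome_f q) q"
    using nome_f_P_nome_deriv(1)[OF q(1)] unfolding f[unfolded N_def] .
  have P: "2 * N 1 - 2 * N 2 - 18 * N 3 + 18 * N 6 = (y - 2 * x) * (y + x) - h"
  proof -
    have "8 * (2 * N 1 - 2 * N 2 - 18 * N 3 + 18 * N 6) = 8 * ((y - 2 * x) * (y + x) - h)"
    proof -
      have "8 * (2 * N 1 - 2 * N 2 - 18 * N 3 + 18 * N 6)
          = 3 * (8 * (N 1 - 2 * N 2 - 3 * N 3 + 6 * N 6) - 8 * (3 * N 3 - N 1))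
            + 8 * (4 * N 2 - 2 * N 1) - 16 * N 1" by (simp add: algebra_simps)
      also have "8 * (N 1 - 2 * N 2 - 3 * N 3 + 6 * N 6)
          = 1 - 8 * N 1 - 4 * (y\<^sup>2 - (h + 2 * (y - 2 * x) * (y + x)))" using h6 by algebra
      also have "8 * (3 * N 3 - N 1) = 1 - 8 * N 1 - 4 * (x\<^sup>2 - h)" using h3 by algebra
      also have "8 * (4 * N 2 - 2 * N 1) = 1 - 8 * N 1 + 4 * (h - (y - 2 * x)\<^sup>2)" using h2 by algebra
      finally show ?thesis using K' by algebra
    qed
    thus ?thesis by (simp only: mult_cancel_left) simp
  qed
  show "nome_deriv nome_P (((y - 2 * x) * (y + x) - h) * nome_P q) q"
    using nome_f_P_nome_deriv(2)[OF q(1)] unfolding P[unfolded N_def] .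
qed

lemma jzeta_torsion_at_0:
  "jzeta 0 0 z6 \<noteq> 0" "jzeta 0 0 z6 = 3 * jzeta 0 0 (z6\<^sup>2)"
proof -
  have nz: "1 - z6 \<noteq> 0" "1 - z6\<^sup>2 \<noteq> 0" using z6_nontrivial by auto
  have x: "jzeta 0 0 (z6\<^sup>2) = (1 + z6\<^sup>2) / (2 * (1 - z6\<^sup>2))" and y: "jzeta 0 0 z6 = (1 + z6) / (2 * (1 - z6))"
    by (simp_all add: jzeta.simps)
  have "1 + z6 \<noteq> 0" using z6_nontrivial(4) by (metis add.commute add_eq_0_iff)
  thus "jzeta 0 0 z6 \<noteq> 0" using nz y by simp
  have "(1 + z6) * (1 - z6\<^sup>2) = 3 * (1 + z6\<^sup>2) * (1 - z6)"
    using z6_square by algebra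
  thus "jzeta 0 0 z6 = 3 * jzeta 0 0 (z6\<^sup>2)"
    unfolding x y using nz by (simp add: frac_eq_eq) algebra
qed

text \<open>
  By the torsion system, \<open>y\<close> has the same logarithmic derivative as the second quotient, and
  \<open>y / (y - 2 x)\<close> the same as the first. So they agree up to constants, which are read off
  at \<open>q = 0\<close>, where both quotients are \<open>1\<close> and \<open>y = 3 x\<close>.
\<close>

lemma nome_f_P_eq_torsion:
  assumes q: "norm q < 1"
  defines "x \<equiv> jzeta 0 q (z6\<^sup>2)" and "y \<equiv> jzeta 0 q z6"
  shows "nome_P q * jzeta 0 0 z6 = y" and "nome_f q * (3 * (y - 2 * x)) = y"
proof -
  have n2: "norm (z6\<^sup>2) = 1" by (simp add: norm_power)
  have dq: "nome_f field_differentiable at q" "nome_P field_differentiable at q"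
    "(\<lambda>q. jzeta 0 q z6) field_differentiable at q" "(\<lambda>q. jzeta 0 q (z6\<^sup>2)) field_differentiable at q"
    if "norm q < 1" for q
    using nome_f_P_nome_deriv[OF that] jzeta_nome_derivative[OF that norm_z6] jzeta_nome_derivative[OF that n2]
    unfolding nome_deriv_def field_differentiable_def by blast+
  have P0: "nome_P 0 = 1" "nome_f 0 = 1" by (simp_all add: nome_P_def nome_f_def)
  have "jzeta 0 q z6 / nome_P q = jzeta 0 0 z6 / nome_P 0"
  proof (rule nome_deriv_0_imp_constant[OF _ _ q])
    fix p :: complex assume p: "norm p < 1"
    show "(\<lambda>q. jzeta 0 q z6 / nome_P q) field_differentiable at p"
      using dq[OF p] nome_f_P_nonzero[OF p] by (intro field_differentiable_divide)
    assume p0: "p \<noteq> 0"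
    let ?x = "jzeta 0 p (z6\<^sup>2)" and ?y = "jzeta 0 p z6" and ?h = "jzeta 1 p (z6\<^sup>2)"
    have "nome_deriv (\<lambda>q. jzeta 0 q z6) (((?y - 2 * ?x) * (?y + ?x) - ?h) * ?y) p"
      using jzeta_torsion_flow(2)[OF p p0] by (simp add: nome_deriv_def algebra_simps)
    from nome_deriv_divide[OF this nome_f_P_nome_deriv_torsion(2)[OF p p0]]
    show "nome_deriv (\<lambda>q. jzeta 0 q z6 / nome_P q) 0 p" using nome_f_P_nonzero[OF p] by simp
  qed
  thus P: "nome_P q * jzeta 0 0 z6 = y"
    using nome_f_P_nonzero[OF q] by (simp add: P0 y_def field_simps)
  have "nome_f q * (jzeta 0 q z6 - 2 * jzeta 0 q (z6\<^sup>2)) / nome_P q = nome_f 0 * (jzeta 0 0 z6 - 2 * jzeta 0 0 (z6\<^sup>2)) / nome_P 0"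
  proof (rule nome_deriv_0_imp_constant[OF _ _ q])
    fix p :: complex assume p: "norm p < 1"
    show "(\<lambda>q. nome_f q * (jzeta 0 q z6 - 2 * jzeta 0 q (z6\<^sup>2)) / nome_P q) field_differentiable at p"
      using dq[OF p] nome_f_P_nonzero[OF p]
      by (intro field_differentiable_divide field_differentiable_mult field_differentiable_diff
            field_differentiable_const)
    assume p0: "p \<noteq> 0"
    let ?x = "jzeta 0 p (z6\<^sup>2)" and ?y = "jzeta 0 p z6" and ?h = "jzeta 1 p (z6\<^sup>2)"
    have "nome_deriv (\<lambda>q. jzeta 0 q z6 - 2 * jzeta 0 q (z6\<^sup>2))
            ((?y * (?y - 2 * ?x) * (?y + ?x) - ?y * ?h)
             - 2 * ((?y - 2 * ?x)\<^sup>2 * (?y + ?x) - ?x * ?h)) p"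
      using jzeta_torsion_flow(1,2)[OF p p0] by (intro nome_deriv_diff_cmult) (simp_all add: nome_deriv_def)
    moreover have "(?y * (?y - 2 * ?x) * (?y + ?x) - ?y * ?h) - 2 * ((?y - 2 * ?x)\<^sup>2 * (?y + ?x) - ?x * ?h)
        = ((?y + ?x) * (4 * ?x - ?y) - ?h) * (?y - 2 * ?x)"
      by (simp add: algebra_simps power2_eq_square)
    ultimately have "nome_deriv (\<lambda>q. jzeta 0 q z6 - 2 * jzeta 0 q (z6\<^sup>2))
       (((?y + ?x) * (4 * ?x - ?y) - ?h) * (?y - 2 * ?x)) p" by simp
    from nome_deriv_divide[OF nome_deriv_mult[OF nome_f_P_nome_deriv_torsion(1)[OF p p0] this]
      nome_f_P_nome_deriv_torsion(2)[OF p p0]]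
    have "nome_deriv (\<lambda>q. nome_f q * (jzeta 0 q z6 - 2 * jzeta 0 q (z6\<^sup>2)) / nome_P q)
      ((2 * (?y - 3 * ?x) * (?y + ?x) + ((?y + ?x) * (4 * ?x - ?y) - ?h) - ((?y - 2 * ?x) * (?y + ?x) - ?h))
        * (nome_f p * (?y - 2 * ?x) / nome_P p)) p" using nome_f_P_nonzero[OF p] by simp
    moreover have "2 * (?y - 3 * ?x) * (?y + ?x) + ((?y + ?x) * (4 * ?x - ?y) - ?h) - ((?y - 2 * ?x) * (?y + ?x) - ?h) = 0"
      by (simp add: algebra_simps)
    ultimately show "nome_deriv (\<lambda>q. nome_f q * (jzeta 0 q z6 - 2 * jzeta 0 q (z6\<^sup>2)) / nome_P q) 0 p"
      by simp
  qed
  also have "\<dots> = jzeta 0 0 (z6\<^sup>2)" using jzeta_torsion_at_0(2) by (simp add: P0)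
  finally have "nome_f q * (y - 2 * x) = jzeta 0 0 (z6\<^sup>2) * nome_P q"
    using nome_f_P_nonzero[OF q] by (simp add: x_def y_def field_simps)
  thus "nome_f q * (3 * (y - 2 * x)) = y"
    using P jzeta_torsion_at_0(2) by algebra
qed

section \<open>The differential equation\<close>

text \<open>
  The chain rule for \<open>q = exp (2 \<pi> \<i> g(w))\<close>, for which \<open>dq/dw = 2 \<pi> \<i> g'(w) q\<close>.
\<close>

lemma nome_deriv_chain:
  assumes "nome_deriv G v (exp (2 * of_real pi * \<i> * g w))" "(g has_field_derivative g') (at w)"
  shows "((\<lambda>w. G (exp (2 * of_real pi * \<i> * g w))) has_field_derivative 2 * of_real pi * \<i> * g' * v) (at w)"
proof -
  let ?q = "\<lambda>w. exp (2 * of_real pi * \<i> * g w)"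
  obtain d where d: "(G has_field_derivative d) (at (?q w))" "?q w * d = v"
    using assms(1) by (auto simp: nome_deriv_def)
  have "(?q has_field_derivative ?q w * (2 * of_real pi * \<i> * g')) (at w)"
    using assms(2) by (auto intro!: derivative_eq_intros)
  hence "(G \<circ> ?q has_field_derivative d * (?q w * (2 * of_real pi * \<i> * g'))) (at w)"
    using d(1) by (rule DERIV_chain[rotated])
  moreover have "d * (?q w * (2 * of_real pi * \<i> * g')) = 2 * of_real pi * \<i> * g' * v"
    unfolding d(2)[symmetric] by (simp add: mult_ac)
  ultimately show ?thesis by (simp add: o_def)
qed

text \<open>
  Along the torsion system each of the linear forms \<open>y - 2 x\<close>, \<open>y - 3 x\<close> and \<open>y + x\<close> has a
  polynomial logarithmic derivative, which keeps the derivative of the quotient in closed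
  form. The factor \<open>\<kappa>\<close> is the change of variable from \<open>log q\<close> to \<open>w\<close>.
\<close>

lemma level6_second_derivative:
  fixes x y h :: "complex \<Rightarrow> complex" and w \<kappa> :: complex
  assumes x: "(x has_field_derivative \<kappa> * ((y w - 2 * x w)\<^sup>2 * (y w + x w) - x w * h w)) (at w)"
    and y: "(y has_field_derivative \<kappa> * (y w * (y w - 2 * x w) * (y w + x w) - y w * h w)) (at w)"
    and h: "(h has_field_derivative \<kappa> * (4 * x w * (y w - 2 * x w)\<^sup>2 * (y w + x w) - (h w)\<^sup>2)) (at w)"
    and nz: "y w - 3 * x w \<noteq> 0" "y w + x w \<noteq> 0"
  defines "A \<equiv> (y w - 2 * x w) * (y w + x w)"
  shows "((\<lambda>w. 3 * (y w - 2 * x w) / (2 * ((y w - 3 * x w) * (y w + x w))) * ((y w - 2 * x w) * (y w + x w) - h w))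
           has_field_derivative
           \<kappa> * (3 * (y w - 2 * x w) / (2 * ((y w - 3 * x w) * (y w + x w)))) *
             (12 * (x w)\<^sup>2 * A - 6 * x w * (y w - x w) * h w)) (at w)"
proof -
  define s where "s = (\<lambda>w. y w - 2 * x w)"
  define a where "a = (\<lambda>w. y w - 3 * x w)"
  define b where "b = (\<lambda>w. y w + x w)"
  define k where "k = h w"
  have s: "(s has_field_derivative \<kappa> * (b w * (4 * x w - y w) - k) * s w) (at w)"
    unfolding s_def b_def k_def
    by (rule DERIV_cong[OF DERIV_diff[OF y DERIV_cmult[OF x]]]) algebra
  have a: "(a has_field_derivative \<kappa> * (- 2 * A - k) * a w) (at w)"
    unfolding a_def k_def A_def
    by (rule DERIV_cong[OF DERIV_diff[OF y DERIV_cmult[OF x]]]) algebra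
  have b: "(b has_field_derivative \<kappa> * (2 * s w * (y w - x w) - k) * b w) (at w)"
    unfolding b_def s_def k_def
    by (rule DERIV_cong[OF DERIV_add[OF y x]]) algebra
  have nz': "a w \<noteq> 0" "b w \<noteq> 0" using nz by (auto simp: a_def b_def)
  \<comment> \<open>the logarithmic derivative of \<open>3 s / (2 a b)\<close>, up to the factor \<open>\<kappa>\<close>\<close>
  define \<mu> where "\<mu> = (b w * (4 * x w - y w) - k) - (- 2 * A - k) - (2 * s w * (y w - x w) - k)"
  have m: "((\<lambda>w. 3 * s w / (2 * (a w * b w))) has_field_derivative \<kappa> * \<mu> * (3 * s w / (2 * (a w * b w)))) (at w)"
  proof (rule DERIV_cong[OF DERIV_divide[OF DERIV_cmult[OF s] DERIV_cmult[OF DERIV_mult[OF a b]]]])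
    show "(3 * (\<kappa> * (b w * (4 * x w - y w) - k) * s w) * (2 * (a w * b w)) -
         3 * s w * (2 * (\<kappa> * (- 2 * A - k) * a w * b w + \<kappa> * (2 * s w * (y w - x w) - k) * b w * a w))) /
        (2 * (a w * b w) * (2 * (a w * b w))) = \<kappa> * \<mu> * (3 * s w / (2 * (a w * b w)))"
    proof -
      have "3 * (\<kappa> * (b w * (4 * x w - y w) - k) * s w) * (2 * (a w * b w)) -
         3 * s w * (2 * (\<kappa> * (- 2 * A - k) * a w * b w + \<kappa> * (2 * s w * (y w - x w) - k) * b w * a w))
         = (\<kappa> * \<mu> * (3 * s w)) * (2 * (a w * b w))"
        unfolding \<mu>_def by algebra
      thus ?thesis using nz' by simp
    qed
  qed (use nz' in auto)
  have e: "((\<lambda>w. s w * b w - h w) has_field_derivative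
      \<kappa> * (A * (y w ^ 2 - 7 * x w * y w + 16 * x w ^ 2 - 2 * k) + k\<^sup>2)) (at w)"
    by (rule DERIV_cong[OF DERIV_diff[OF DERIV_mult[OF s b] h]])
       (unfold s_def b_def k_def A_def, algebra)
  have "((\<lambda>w. 3 * s w / (2 * (a w * b w)) * (s w * b w - h w)) has_field_derivative
          \<kappa> * (3 * s w / (2 * (a w * b w))) * (12 * (x w)\<^sup>2 * A - 6 * x w * (y w - x w) * k)) (at w)"
  proof (rule DERIV_cong[OF DERIV_mult[OF m e]])
    define M where "M = 3 * s w / (2 * (a w * b w))"
    have "\<kappa> * \<mu> * M * (s w * b w - h w)
         + \<kappa> * (A * (y w ^ 2 - 7 * x w * y w + 16 * x w ^ 2 - 2 * k) + k\<^sup>2) * M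
       = \<kappa> * M * (12 * (x w)\<^sup>2 * A - 6 * x w * (y w - x w) * k)"
      unfolding \<mu>_def A_def s_def b_def k_def by algebra
    thus "\<kappa> * \<mu> * (3 * s w / (2 * (a w * b w))) * (s w * b w - h w)
         + \<kappa> * (A * (y w ^ 2 - 7 * x w * y w + 16 * x w ^ 2 - 2 * k) + k\<^sup>2) * (3 * s w / (2 * (a w * b w)))
       = \<kappa> * (3 * s w / (2 * (a w * b w))) * (12 * (x w)\<^sup>2 * A - 6 * x w * (y w - x w) * k)"
      unfolding M_def .
  qed
  thus ?thesis unfolding s_def a_def b_def k_def .
qed

text \<open>
  In terms of \<open>s = y - 2 x\<close>, \<open>a = y - 3 x\<close> and \<open>b = y + x\<close> one has \<open>w = y / (3 s)\<close>,
  \<open>w - 1 = - 2 a / (3 s)\<close>, \<open>w - 1/9 = 2 b / (9 s)\<close> and \<open>w - 1/3 = 2 x / (3 s)\<close>. So the four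
  special points of the equation correspond to the four linear forms, and what remains is a
  polynomial identity.
\<close>

lemma level6_ode_algebra:
  fixes x y h w :: complex
  assumes nz: "y \<noteq> 0" "y - 2 * x \<noteq> 0" "y - 3 * x \<noteq> 0" "y + x \<noteq> 0"
    and w: "w = y / (3 * (y - 2 * x))"
  defines "A \<equiv> (y - 2 * x) * (y + x)" and "m \<equiv> 3 * (y - 2 * x) / (2 * ((y - 3 * x) * (y + x)))"
  shows "w \<noteq> 0" "w \<noteq> 1" "w \<noteq> 1 / 9"
    and "1 / (2 * (y - 3 * x) * (y + x) * w) * m * (12 * x\<^sup>2 * A - 6 * x * (y - x) * h)
         + (- (1 / w) + 1 / (w - 1) + 1 / (w - 1 / 9)) * (m * (A - h))
         - (w - 1 / 3) / (3 * w\<^sup>2 * (w - 1) * (w - 1 / 9)) * y = 0"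
proof -
  define s where "s = y - 2 * x"
  define a where "a = y - 3 * x"
  define b where "b = y + x"
  have nz': "s \<noteq> 0" "a \<noteq> 0" "b \<noteq> 0" using nz by (auto simp: s_def a_def b_def)
  have w0: "w = y / (3 * s)" using w by (simp add: s_def)
  have w1: "w - 1 = - 2 * a / (3 * s)"
  proof -
    have "w - 1 = (y - 3 * s) / (3 * s)" unfolding w0 using nz' by (simp add: diff_divide_distrib)
    also have "y - 3 * s = - 2 * a" by (simp add: s_def a_def)
    finally show ?thesis .
  qed
  have w9: "w - 1 / 9 = 2 * b / (9 * s)"
  proof -
    have "w - 1 / 9 = (3 * y - s) / (9 * s)" unfolding w0 using nz' by (simp add: field_simps)
    also have "3 * y - s = 2 * b" by (simp add: s_def b_def)
    finally show ?thesis .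
  qed
  have w3: "w - 1 / 3 = 2 * x / (3 * s)"
  proof -
    have "w - 1 / 3 = (y - s) / (3 * s)" unfolding w0 using nz' by (simp add: diff_divide_distrib)
    also have "y - s = 2 * x" by (simp add: s_def)
    finally show ?thesis .
  qed
  show nzw: "w \<noteq> 0" "w \<noteq> 1" "w \<noteq> 1 / 9"
    using w0 w1 w9 nz nz' by auto
  have r: "- (1 / w) + 1 / (w - 1) + 1 / (w - 1 / 9) = - (3 * s / y) - 3 * s / (2 * a) + 9 * s / (2 * b)"
    unfolding w1 w9 unfolding w0 by simp
  have p: "(w - 1 / 3) / (3 * w\<^sup>2 * (w - 1) * (w - 1 / 9)) * y = - (27 * x * s ^ 3 / (2 * y * a * b))"
    unfolding w1 w9 w3 unfolding w0 using nz nz'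
    by (simp add: divide_simps power2_eq_square power3_eq_cube)
  have k: "1 / (2 * a * b * w) = 3 * s / (2 * y * a * b)"
    unfolding w0 using nz nz' by (simp add: field_simps)
  have "3 * s / (2 * y * a * b) * (3 * s / (2 * (a * b))) * (12 * x\<^sup>2 * A - 6 * x * (y - x) * h)
      + (- (3 * s / y) - 3 * s / (2 * a) + 9 * s / (2 * b)) * (3 * s / (2 * (a * b)) * (A - h))
      - (- (27 * x * s ^ 3 / (2 * y * a * b))) =
      9 * s\<^sup>2 / (4 * y * a\<^sup>2 * b\<^sup>2) * ((12 * x\<^sup>2 * A - 6 * x * (y - x) * h)
        + (- 2 * a * b - y * b + 3 * y * a) * (A - h) + 6 * x * s * a * b)"
    using nz nz' by (simp add: divide_simps) algebra
  also have "(12 * x\<^sup>2 * A - 6 * x * (y - x) * h) + (- 2 * a * b - y * b + 3 * y * a) * (A - h) + 6 * x * s * a * b = 0"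
    unfolding A_def s_def a_def b_def by algebra
  finally show "1 / (2 * (y - 3 * x) * (y + x) * w) * m * (12 * x\<^sup>2 * A - 6 * x * (y - x) * h)
         + (- (1 / w) + 1 / (w - 1) + 1 / (w - 1 / 9)) * (m * (A - h))
         - (w - 1 / 3) / (3 * w\<^sup>2 * (w - 1) * (w - 1 / 9)) * y = 0"
    unfolding r p m_def s_def [symmetric] a_def [symmetric] b_def [symmetric] k by simp
qed

theorem proposition8p2:
  fixes U :: "complex set" and \<tau> :: "complex \<Rightarrow> complex"
  assumes "local_holomorphic_inverse eta_f U \<tau>"
  defines "P \<equiv> (\<lambda>f. eta_P (\<tau> f))"
  shows "P holomorphic_on U \<and>
         (\<forall>f\<in>U. f \<noteq> 0 \<and> f \<noteq> 1 \<and> f \<noteq> 1/9 \<and>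
            deriv (deriv P) f
            + (- (1 / f) + 1 / (f - 1) + 1 / (f - 1/9)) * deriv P f
            - (f - 1/3) / (3 * f^2 * (f - 1) * (f - 1/9)) * P f = 0)"
proof -
  have U: "open U" and hol: "\<tau> holomorphic_on U" and im: "\<And>f. f \<in> U \<Longrightarrow> Im (\<tau> f) > 0"
    and inv: "\<And>f. f \<in> U \<Longrightarrow> eta_f (\<tau> f) = f"
    using assms(1) by (auto simp: local_holomorphic_inverse_def upper_half_plane_def)
  define q where "q = (\<lambda>f. exp (2 * of_real pi * \<i> * \<tau> f))"
  define x where "x = (\<lambda>f. jzeta 0 (q f) (z6\<^sup>2))"
  define y where "y = (\<lambda>f. jzeta 0 (q f) z6)"
  define h where "h = (\<lambda>f. jzeta 1 (q f) (z6\<^sup>2))"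
  \<comment> \<open>the derivative of \<open>log q\<close> with respect to \<open>f\<close>\<close>
  define \<kappa> where "\<kappa> = (\<lambda>f. 2 * of_real pi * \<i> * deriv \<tau> f)"
  define c where "c = 1 / jzeta 0 0 z6"
  define E where "E = (\<lambda>f. 3 * (y f - 2 * x f) / (2 * ((y f - 3 * x f) * (y f + x f))) * ((y f - 2 * x f) * (y f + x f) - h f))"
  have q: "norm (q f) < 1" "q f \<noteq> 0" if "f \<in> U" for f
    using im[OF that] by (auto simp: q_def)
  have d\<tau>: "(\<tau> has_field_derivative deriv \<tau> f) (at f)" if "f \<in> U" for f
    using holomorphic_derivI[OF hol U that] .
  have dx: "(x has_field_derivative \<kappa> f * ((y f - 2 * x f)\<^sup>2 * (y f + x f) - x f * h f)) (at f)"
    and dy: "(y has_field_derivative \<kappa> f * (y f * (y f - 2 * x f) * (y f + x f) - y f * h f)) (at f)"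
    and dh: "(h has_field_derivative \<kappa> f * (4 * x f * (y f - 2 * x f)\<^sup>2 * (y f + x f) - (h f)\<^sup>2)) (at f)"
    and df: "((\<lambda>f. nome_f (q f)) has_field_derivative \<kappa> f * ((2 * (y f - 3 * x f) * (y f + x f)) * nome_f (q f))) (at f)"
    if "f \<in> U" for f
    unfolding x_def y_def h_def \<kappa>_def q_def
    using jzeta_torsion_flow[OF q[OF that]] nome_f_P_nome_deriv_torsion(1)[OF q[OF that]]
    by (intro nome_deriv_chain d\<tau> that; simp add: nome_deriv_def q_def)+
  have qf: "nome_f (q f) = f" if "f \<in> U" for f
    using inv[OF that] by (simp add: eta_f_P_eq q_def)
  have f_eq: "f * (3 * (y f - 2 * x f)) = y f" if "f \<in> U" for f
    using nome_f_P_eq_torsion(2)[OF q(1)[OF that]] qf[OF that] by (simp add: x_def y_def)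
  have P_eq: "P f = c * y f" if "f \<in> U" for f
    using nome_f_P_eq_torsion(1)[OF q(1)[OF that]] jzeta_torsion_at_0(1)
    by (simp add: P_def c_def y_def eta_f_P_eq q_def field_simps)
  have P_nz: "P f \<noteq> 0" if "f \<in> U" for f
    using nome_f_P_nonzero(2)[OF q(1)[OF that]] by (simp add: P_def eta_f_P_eq q_def)
  have f_nz: "f \<noteq> 0" if "f \<in> U" for f
    using nome_f_P_nonzero(1)[OF q(1)[OF that]] qf[OF that] by simp
  have y_nz: "y f \<noteq> 0" if "f \<in> U" for f
    using P_nz[OF that] P_eq[OF that] by auto
  have s_nz: "y f - 2 * x f \<noteq> 0" if "f \<in> U" for f
    using f_eq[OF that] y_nz[OF that] by auto
  \<comment> \<open>differentiating \<open>f(\<tau>(f)) = f\<close>; hence \<open>y - 3 x\<close> and \<open>y + x\<close> have no zeros on \<open>U\<close>\<close>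
  have \<kappa>: "\<kappa> f * (2 * (y f - 3 * x f) * (y f + x f) * f) = 1" if "f \<in> U" for f
  proof -
    have "((\<lambda>f. nome_f (q f)) has_field_derivative 1) (at f)"
      by (rule has_field_derivative_transform_within_open[OF DERIV_ident U that]) (simp add: qf)
    from DERIV_unique[OF this df[OF that]] show ?thesis using qf[OF that] by simp
  qed
  have nz: "y f - 3 * x f \<noteq> 0" "y f + x f \<noteq> 0" if "f \<in> U" for f
    using \<kappa>[OF that] by auto
  have \<kappa>_eq: "\<kappa> f = 1 / (2 * (y f - 3 * x f) * (y f + x f) * f)" if "f \<in> U" for f
  proof -
    have "2 * (y f - 3 * x f) * (y f + x f) * f \<noteq> 0" using nz[OF that] f_nz[OF that] by simp
    thus ?thesis using \<kappa>[OF that] by (rule eq_divide_imp)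
  qed
  have w: "f = y f / (3 * (y f - 2 * x f))" if "f \<in> U" for f
  proof -
    have "3 * (y f - 2 * x f) \<noteq> 0" using s_nz[OF that] by simp
    thus ?thesis using f_eq[OF that] by (rule eq_divide_imp)
  qed
  have dP: "(P has_field_derivative c * E f) (at f)" if "f \<in> U" for f
  proof -
    have "((\<lambda>f. c * y f) has_field_derivative
            c * (\<kappa> f * (y f * (y f - 2 * x f) * (y f + x f) - y f * h f))) (at f)"
      by (intro DERIV_cmult dy that)
    moreover have "\<kappa> f * (y f * (y f - 2 * x f) * (y f + x f) - y f * h f) = E f"
    proof -
      have "\<kappa> f * y f = 3 * (y f - 2 * x f) / (2 * ((y f - 3 * x f) * (y f + x f)))"
        unfolding \<kappa>_eq[OF that] using nz[OF that] f_nz[OF that] f_eq[OF that]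
        by (simp add: frac_eq_eq) (simp add: mult_ac)
      moreover have "\<kappa> f * (y f * (y f - 2 * x f) * (y f + x f) - y f * h f)
          = \<kappa> f * y f * ((y f - 2 * x f) * (y f + x f) - h f)" by (simp add: algebra_simps)
      ultimately show ?thesis by (simp only: E_def)
    qed
    ultimately have "((\<lambda>f. c * y f) has_field_derivative c * E f) (at f)" by simp
    thus ?thesis
      by (rule has_field_derivative_transform_within_open[OF _ U that]) (simp add: P_eq)
  qed
  have holP: "P holomorphic_on U"
    using dP U by (auto simp: holomorphic_on_open)
  moreover have "f \<noteq> 0 \<and> f \<noteq> 1 \<and> f \<noteq> 1/9 \<and>
            deriv (deriv P) f
            + (- (1 / f) + 1 / (f - 1) + 1 / (f - 1/9)) * deriv P f
            - (f - 1/3) / (3 * f^2 * (f - 1) * (f - 1/9)) * P f = 0" if f: "f \<in> U" for f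
  proof -
    let ?A = "(y f - 2 * x f) * (y f + x f)"
    let ?m = "3 * (y f - 2 * x f) / (2 * ((y f - 3 * x f) * (y f + x f)))"
    let ?E' = "\<kappa> f * ?m * (12 * (x f)\<^sup>2 * ?A - 6 * x f * (y f - x f) * h f)"
    note alg = level6_ode_algebra[OF y_nz[OF f] s_nz[OF f] nz[OF f] w[OF f]]
    have "((\<lambda>f. c * E f) has_field_derivative c * ?E') (at f)"
      unfolding E_def by (intro DERIV_cmult level6_second_derivative dx dy dh f nz)
    hence "(deriv P has_field_derivative c * ?E') (at f)"
      by (rule has_field_derivative_transform_within_open[OF _ U f])
         (use dP DERIV_imp_deriv in \<open>metis\<close>)
    hence P2: "deriv (deriv P) f = c * ?E'" by (rule DERIV_imp_deriv)
    have P1: "deriv P f = c * E f" using dP[OF f] by (rule DERIV_imp_deriv)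
    have "?E' + (- (1 / f) + 1 / (f - 1) + 1 / (f - 1/9)) * E f
            - (f - 1/3) / (3 * f^2 * (f - 1) * (f - 1/9)) * y f = 0"
      using alg(4)[of "h f"] unfolding \<kappa>_eq[OF f] E_def .
    hence "c * (?E' + (- (1 / f) + 1 / (f - 1) + 1 / (f - 1/9)) * E f
            - (f - 1/3) / (3 * f^2 * (f - 1) * (f - 1/9)) * y f) = 0" by simp
    moreover have "c * (e + r * d - p * v) = c * e + r * (c * d) - p * (c * v)" for e r d p v
      by (simp add: algebra_simps)
    ultimately show ?thesis unfolding P2 P1 P_eq[OF f] using alg(1-3) by metis
  qed
  ultimately show ?thesis by blast
qed

end
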